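(* The one-relator group $$G=\langle a,b,d\mid a^{b^2}(a^{b})^{-1}a=(a^{d^2})^{-1}a^{d}a^{-1}\rangle$$ is generalized torsion-free and not bi-orderable.
   Context: Notation: $x^y=y^{-1}xy$. A group is bi-orderable if it admits a strict total order invariant under both left and right multiplication. An element $g\neq1$ is generalized torsion if $g^{h_1}\cdots g^{h_n}=1$ for some $n\ge1$ and $h_1,\dots,h_n\in G$; a group is generalized torsion-free (GTF) if it has no such elements. *)

theory Defs
  imports "HOL-Algebra.Group"
begin

definition conj :: "('a, 'b) monoid_scheme \<Rightarrow> 'a \<Rightarrow> 'a \<Rightarrow> 'a" where
  "conj G x y = inv\<^bsub>G\<^esub> y \<otimes>\<^bsub>G\<^esub> x \<otimes>\<^bsub>G\<^esub> y"

definition conj_prod :: "('a, 'b) monoid_scheme \<Rightarrow> 'a \<Rightarrow> 'a list \<Rightarrow> 'a" where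
  "conj_prod G g hs = foldr (\<lambda>h acc. conj G g h \<otimes>\<^bsub>G\<^esub> acc) hs \<one>\<^bsub>G\<^esub>"

definition generalized_torsion :: "('a, 'b) monoid_scheme \<Rightarrow> 'a \<Rightarrow> bool" where
  "generalized_torsion G g \<longleftrightarrow> g \<in> carrier G \<and> g \<noteq> \<one>\<^bsub>G\<^esub> \<and>
     (\<exists>hs. hs \<noteq> [] \<and> set hs \<subseteq> carrier G \<and> conj_prod G g hs = \<one>\<^bsub>G\<^esub>)"

definition generalized_torsion_free :: "('a, 'b) monoid_scheme \<Rightarrow> bool" where
  "generalized_torsion_free G \<longleftrightarrow> (\<nexists>g. generalized_torsion G g)"

definition bi_orderable :: "('a, 'b) monoid_scheme \<Rightarrow> bool" where
  "bi_orderable G \<longleftrightarrow> (\<exists>less :: 'a \<Rightarrow> 'a \<Rightarrow> bool.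
     (\<forall>x\<in>carrier G. \<not> less x x) \<and>
     (\<forall>x\<in>carrier G. \<forall>y\<in>carrier G. \<forall>z\<in>carrier G. less x y \<longrightarrow> less y z \<longrightarrow> less x z) \<and>
     (\<forall>x\<in>carrier G. \<forall>y\<in>carrier G. x \<noteq> y \<longrightarrow> less x y \<or> less y x) \<and>
     (\<forall>x\<in>carrier G. \<forall>y\<in>carrier G. \<forall>z\<in>carrier G. less x y \<longrightarrow>
        less (z \<otimes>\<^bsub>G\<^esub> x) (z \<otimes>\<^bsub>G\<^esub> y) \<and> less (x \<otimes>\<^bsub>G\<^esub> z) (y \<otimes>\<^bsub>G\<^esub> z)))"

datatype gen = Ga | Gb | Gd

text \<open>Letters: (True, x) is x, (False, x) is x^{-1}. Words are lists of letters.\<close>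
type_synonym letter = "bool \<times> gen"

definition pos :: "gen \<Rightarrow> letter" where "pos x = (True, x)"
definition neg :: "gen \<Rightarrow> letter" where "neg x = (False, x)"

text \<open>LHS: a^{b^2} (a^b)^{-1} a = b^{-2} a b^2 . b^{-1} a^{-1} b . a\<close>
definition rel_lhs :: "letter list" where
  "rel_lhs = [neg Gb, neg Gb, pos Ga, pos Gb, pos Gb] @ [neg Gb, neg Ga, pos Gb] @ [pos Ga]"

text \<open>RHS: (a^{d^2})^{-1} a^d a^{-1} = d^{-2} a^{-1} d^2 . d^{-1} a d . a^{-1}\<close>
definition rel_rhs :: "letter list" where
  "rel_rhs = [neg Gd, neg Gd, neg Ga, pos Gd, pos Gd] @ [neg Gd, pos Ga, pos Gd] @ [neg Ga]"

inductive word_eq :: "letter list \<Rightarrow> letter list \<Rightarrow> bool" where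
  refl: "word_eq w w"
| sym: "word_eq v w \<Longrightarrow> word_eq w v"
| trans: "word_eq u v \<Longrightarrow> word_eq v w \<Longrightarrow> word_eq u w"
| cancel: "word_eq (u @ [(s, x), (\<not> s, x)] @ v) (u @ v)"
| relator: "word_eq (u @ rel_lhs @ v) (u @ rel_rhs @ v)"

definition word_class :: "letter list \<Rightarrow> letter list set" where
  "word_class w = {v. word_eq w v}"

definition onerel_group :: "letter list set monoid" where
  "onerel_group = \<lparr> carrier = range word_class,
         mult = (\<lambda>X Y. {v. \<exists>x\<in>X. \<exists>y\<in>Y. word_eq (x @ y) v}),
         one = word_class [] \<rparr>"

end

theory Submission
  imports Defs "HOL-Library.Sublist" Complex_Main
begin

text \<open>
  In a bi-ordered group with \<open>a > 1\<close> the left-hand side of the relation is positive and the right-hand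
  side is negative, while \<open>a \<noteq> 1\<close> because the number of letters \<open>a\<close> is well defined modulo 2.

  For the other half let \<open>F\<close> be the free group on \<open>b, d\<close> and \<open>N\<close> the kernel of \<open>G \<rightarrow> F\<close>. Homomorphisms
  from \<open>N\<close> to a group \<open>\<Gamma>\<close> are functions \<open>f : F \<rightarrow> \<Gamma>\<close> (the values at the conjugates \<open>a^w\<close>) solving one
  equation for each \<open>w\<close>. On the tree \<open>F\<close> these equations can be solved outwards from any vertex, so
  \<open>N\<close> is free, hence residually unitriangular. If \<open>g \<in> N\<close> is generalized torsion, take the shallowest
  superdiagonal entry \<open>z(f)\<close> on which \<open>g\<close> is ever nontrivial; then \<open>\<Sum> z(f translated by u) = 0\<close>
  for all solutions \<open>f\<close>, where \<open>u\<close> runs over finitely many elements of \<open>F\<close>. Two solutions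
  that agree on the two-vertex separator of an edge can be glued along it, and applying this at the
  translate farthest from the origin shrinks the window in \<open>F\<close> on which \<open>z\<close> depends, until it is a
  single edge. There the gluing argument shows that \<open>z\<close> is determined by its values on solutions in
  cyclic groups, so \<open>z\<close> is linear in one real solution, and real solutions positive on all the
  translates give a contradiction.
\<close>

section \<open>Free groups\<close>

text \<open>Elements of \<open>F\<close> are the vertices of a tree whose edges multiply by a letter
  on the left, so \<open>F\<close> acts on solutions by right translation. The conjugators of a
  torsion relation range over all of \<open>G\<close>. On the first superdiagonal where anything is
  nontrivial, entries are additive and conjugation in the matrix group does not change them; a
  conjugator then matters only through its image in \<open>F\<close>, whence the sum over
  translates.

  The window shrinks to an edge rather than to a vertex because neighbouring equations share two
  adjacent vertices, and gluing has to respect both.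

  A \<open>G\<close>-invariant order on \<open>N\<close> would make \<open>G\<close> bi-orderable,
  so no fixed notion of positivity can serve for all \<open>g\<close>. The real solution that gives
  the contradiction is chosen after \<open>z\<close>, according to the ratio of its two
  coefficients.\<close>

definition linv :: "bool \<times> 'x \<Rightarrow> bool \<times> 'x" where
  "linv c = (\<not> fst c, snd c)"

lemma linv_linv [simp]: "linv (linv c) = c"
  by (simp add: linv_def)

lemma linv_neq [simp]: "linv c \<noteq> c" "c \<noteq> linv c"
  by (auto simp: linv_def prod_eq_iff)

lemma linv_pair [simp]: "linv (s, x) = (\<not> s, x)"
  by (simp add: linv_def)

lemma linv_eq_iff [simp]: "linv c = linv e \<longleftrightarrow> c = e"
  by (metis linv_linv)

fun lcons :: "bool \<times> 'x \<Rightarrow> (bool \<times> 'x) list \<Rightarrow> (bool \<times> 'x) list" where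
  "lcons c [] = [c]"
| "lcons c (e # w) = (if e = linv c then w else c # e # w)"

abbreviation reduced :: "(bool \<times> 'x) list \<Rightarrow> bool" where
  "reduced \<equiv> successively (\<lambda>c e. e \<noteq> linv c)"

lemma reduced_Cons: "reduced (c # w) \<longleftrightarrow> reduced w \<and> (w \<noteq> [] \<longrightarrow> hd w \<noteq> linv c)"
  by (cases w) auto

lemma reduced_lcons: "reduced w \<Longrightarrow> reduced (lcons c w)"
  by (cases w) (auto simp: reduced_Cons)

lemma lcons_eq_Cons: "reduced (c # w) \<Longrightarrow> lcons c w = c # w"
  by (cases w) auto

lemma lcons_linv: "reduced w \<Longrightarrow> lcons (linv c) (lcons c w) = w"
  by (cases w) (auto simp: reduced_Cons lcons_eq_Cons)

lemma lcons_linv': "reduced w \<Longrightarrow> lcons c (lcons (linv c) w) = w"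
  using lcons_linv[of w "linv c"] by simp

lemma reduced_foldr_lcons: "reduced w \<Longrightarrow> reduced (foldr lcons v w)"
  by (induction v) (auto intro: reduced_lcons)

text \<open>Each letter permutes the reduced words, with the inverse letter as inverse permutation.
  Associativity of the product is read off from this action.\<close>

lemma foldr_lcons_lcons:
  "reduced w \<Longrightarrow> foldr lcons (lcons c v) w = lcons c (foldr lcons v w)"
  by (cases v) (auto simp: lcons_linv' reduced_foldr_lcons)

lemma foldr_lcons_assoc:
  "reduced w \<Longrightarrow> foldr lcons (foldr lcons u v) w = foldr lcons u (foldr lcons v w)"
  by (induction u) (auto simp: foldr_lcons_lcons)

lemma foldr_lcons_append:
  "reduced (u @ w) \<Longrightarrow> foldr lcons u w = u @ w"
  by (induction u) (auto simp: reduced_Cons lcons_eq_Cons)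

lemma foldr_lcons_inverse: "foldr lcons (rev (map linv u)) u = []"
  by (induction u) auto

lemma reduced_rev_linv: "reduced w \<Longrightarrow> reduced (rev (map linv w))"
proof -
  assume "reduced w"
  then have "successively (\<lambda>x y. x \<noteq> linv y) (map linv w)"
    by (induction w rule: induct_list012) auto
  then show ?thesis
    by (simp add: successively_rev)
qed

typedef 'x fg = "{w :: (bool \<times> 'x) list. reduced w}"
  by (rule exI[of _ "[]"]) simp

setup_lifting type_definition_fg

instantiation fg :: (type) group_add
begin

lift_definition zero_fg :: "'a fg" is "[]" by simp
lift_definition plus_fg :: "'a fg \<Rightarrow> 'a fg \<Rightarrow> 'a fg" is "foldr lcons"
  by (rule reduced_foldr_lcons)
lift_definition uminus_fg :: "'a fg \<Rightarrow> 'a fg" is "\<lambda>w. rev (map linv w)"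
  by (rule reduced_rev_linv)
definition minus_fg :: "'a fg \<Rightarrow> 'a fg \<Rightarrow> 'a fg" where "minus_fg x y = x + - y"

instance
proof
  fix a b c :: "'a fg"
  show "a + b + c = a + (b + c)" by transfer (rule foldr_lcons_assoc)
  show "0 + a = a" by transfer simp
  show "a + 0 = a" by transfer (simp add: foldr_lcons_append)
  show "- a + a = 0" by transfer (rule foldr_lcons_inverse)
  show "a + - b = a - b" by (simp add: minus_fg_def)
qed

end

lift_definition fletter :: "bool \<times> 'x \<Rightarrow> 'x fg" is "\<lambda>c. [c]" by simp

abbreviation fgen :: "'x \<Rightarrow> 'x fg" where "fgen x \<equiv> fletter (True, x)"

abbreviation flen :: "'x fg \<Rightarrow> nat" where "flen v \<equiv> length (Rep_fg v)"

lemma reduced_Rep [simp]: "reduced (Rep_fg v)"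
  using Rep_fg by blast

lemma Rep_fletter_plus: "Rep_fg (fletter c + v) = lcons c (Rep_fg v)"
  by transfer simp

lemma uminus_fletter: "- fletter c = fletter (linv c)"
  by transfer simp

lemma fletter_False: "fletter (False, x) = - fgen x"
  by (simp add: uminus_fletter)

lemma fletter_cancel [simp]:
  "fletter (False, x) + (fletter (True, x) + v) = v"
  "fletter (True, x) + (fletter (False, x) + v) = v"
  by (simp_all add: fletter_False)

lemma Rep_zero [simp]: "Rep_fg 0 = []"
  by transfer simp

text \<open>In contrast to \<open>Rep_fg\<close>, the word need not be reduced; paths in the tree
  are written this way.\<close>

definition lword :: "(bool \<times> 'x) list \<Rightarrow> 'x fg" where
  "lword w = sum_list (map fletter w)"

lemma lword_simps [simp]:
  "lword [] = 0" "lword (c # w) = fletter c + lword w" "lword (v @ w) = lword v + lword w"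
  by (simp_all add: lword_def)

lemma Rep_lword_plus: "Rep_fg (lword w + v) = foldr lcons w (Rep_fg v)"
  by (induction w) (simp_all add: Rep_fletter_plus add.assoc)

lemma Rep_lword: "reduced w \<Longrightarrow> Rep_fg (lword w) = w"
  using Rep_lword_plus[of w 0] foldr_lcons_append[of w "[]"] by simp

lemma lword_Rep [simp]: "lword (Rep_fg v) = v"
  by (simp add: Rep_fg_inject[symmetric] Rep_lword)

text \<open>The homomorphism of the universal property. Additive notation is kept for noncommutative
  targets too, since \<open>group_add\<close> does not assume commutativity.\<close>

definition fhom :: "('x \<Rightarrow> 'g::group_add) \<Rightarrow> 'x fg \<Rightarrow> 'g" where
  "fhom h v = sum_list (map (\<lambda>(s, x). if s then h x else - h x) (Rep_fg v))"

lemma fhom_lcons: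
  "sum_list (map (\<lambda>(s, x). if s then h x else - h x :: 'g::group_add) (lcons (t, y) w))
    = (if t then h y else - h y) + sum_list (map (\<lambda>(s, x). if s then h x else - h x) w)"
  by (cases w) (auto simp: add.assoc[symmetric])

lemma fhom_zero [simp]: "fhom h 0 = 0"
  by (simp add: fhom_def)

lemma fhom_fletter_plus: "fhom h (fletter c + v) = (if fst c then h (snd c) else - h (snd c)) + fhom h v"
  by (cases c) (simp only: fhom_def Rep_fletter_plus fhom_lcons fst_conv snd_conv)

lemma fhom_fletter: "fhom h (fletter c) = (if fst c then h (snd c) else - h (snd c))"
  using fhom_fletter_plus[of h c 0] by simp

lemma fhom_fgen [simp]: "fhom h (fgen x) = h x"
  by (simp add: fhom_fletter)

lemma fhom_plus [simp]: "fhom h (u + v) = fhom h u + fhom h v"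
proof -
  have "fhom h (lword w + v) = fhom h (lword w) + fhom h v" for w
    by (induction w) (simp_all add: add.assoc fhom_fletter_plus)
  from this[of "Rep_fg u"] show ?thesis by simp
qed

lemma hom_uminus:
  fixes \<phi> :: "'a::group_add \<Rightarrow> 'b::group_add"
  assumes "\<And>x y. \<phi> (x + y) = \<phi> x + \<phi> y"
  shows "\<phi> (- x) = - \<phi> x" "\<phi> 0 = 0" "\<phi> (x - y) = \<phi> x - \<phi> y"
proof -
  have 0: "\<phi> 0 = 0" using assms[of 0 0] by (metis add.right_neutral add_left_cancel)
  have u: "\<phi> (- x) = - \<phi> x" for x
    using assms[of "- x" x] 0 by (simp add: eq_neg_iff_add_eq_0)
  show "\<phi> (- x) = - \<phi> x" "\<phi> 0 = 0" by (fact u, fact 0)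
  show "\<phi> (x - y) = \<phi> x - \<phi> y"
    using assms[of x "- y"] by (simp add: u)
qed

section \<open>Infinite unitriangular matrices\<close>

typedef umat = "{m :: nat \<Rightarrow> nat \<Rightarrow> real. (\<forall>i. m i i = 1) \<and> (\<forall>i j. j < i \<longrightarrow> m i j = 0)}"
  morphisms ent Abs_umat
  by (rule exI[of _ "\<lambda>i j. if i = j then 1 else 0"]) simp

setup_lifting type_definition_umat

text \<open>The recursion is entry \<open>(i, j)\<close> of the equation "\<open>m\<close> times its
  inverse is 1", solved for the term with \<open>l = i\<close>, whose coefficient is the diagonal
  entry 1.\<close>

function uinv :: "(nat \<Rightarrow> nat \<Rightarrow> real) \<Rightarrow> nat \<Rightarrow> nat \<Rightarrow> real" where
  "uinv m i j = (if j < i then 0 else if i = j then 1 else - (\<Sum>l\<in>{i<..j}. m i l * uinv m l j))"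

  by auto
termination by (relation "measure (\<lambda>(m, i, j). j - i)") auto

declare uinv.simps [simp del]

lemma sum_atMost_split_upper:
  fixes f :: "nat \<Rightarrow> real"
  assumes "i \<le> j" "\<And>l. l < i \<Longrightarrow> f l = 0"
  shows "(\<Sum>l\<le>j. f l) = f i + (\<Sum>l\<in>{i<..j}. f l)"
proof -
  have "(\<Sum>l\<le>j. f l) = (\<Sum>l\<in>insert i {i<..j}. f l)"
  proof (rule sum.mono_neutral_right)
    show "\<forall>l\<in>{..j} - insert i {i<..j}. f l = 0"
      using assms by (metis DiffE atMost_iff greaterThanAtMost_iff insertCI linorder_neqE_nat)
  qed (use assms in auto)
  then show ?thesis by simp
qed

instantiation umat :: group_add
begin

lift_definition zero_umat :: umat is "\<lambda>i j. if i = j then 1 else 0" by simp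
lift_definition plus_umat :: "umat \<Rightarrow> umat \<Rightarrow> umat" is
  "\<lambda>m n i j. \<Sum>l\<le>j. m i l * n l j"
proof (intro conjI allI impI)
  fix m n :: "nat \<Rightarrow> nat \<Rightarrow> real" and i j :: nat
  assume *: "(\<forall>i. m i i = 1) \<and> (\<forall>i j. j < i \<longrightarrow> m i j = 0)"
     "(\<forall>i. n i i = 1) \<and> (\<forall>i j. j < i \<longrightarrow> n i j = 0)"
  show "(\<Sum>l\<le>i. m i l * n l i) = 1"
    using * by (subst sum_atMost_split_upper[of i]) auto
  show "(\<Sum>l\<le>j. m i l * n l j) = 0" if "j < i"
    using * that by (intro sum.neutral) auto
qed
lift_definition uminus_umat :: "umat \<Rightarrow> umat" is uinv
  by (auto simp: uinv.simps)
definition minus_umat :: "umat \<Rightarrow> umat \<Rightarrow> umat" where "minus_umat x y = x + - y"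

instance
proof
  fix a b c :: umat
  show assoc: "a + b + c = a + (b + c)" for a b c :: umat
  proof (transfer, intro ext)
    fix a b c :: "nat \<Rightarrow> nat \<Rightarrow> real" and i j :: nat
    assume "(\<forall>i. b i i = 1) \<and> (\<forall>i j. j < i \<longrightarrow> b i j = 0)"
    then have "(\<Sum>k\<le>l. a i k * b k l) = (\<Sum>k\<le>j. a i k * b k l)" if "l \<le> j" for l
      using that by (intro sum.mono_neutral_left) auto
    then have "(\<Sum>l\<le>j. (\<Sum>k\<le>l. a i k * b k l) * c l j) = (\<Sum>l\<le>j. \<Sum>k\<le>j. a i k * b k l * c l j)"
      by (simp add: sum_distrib_right)
    also have "\<dots> = (\<Sum>k\<le>j. \<Sum>l\<le>j. a i k * b k l * c l j)"
      by (rule sum.swap)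
    finally show "(\<Sum>l\<le>j. (\<Sum>k\<le>l. a i k * b k l) * c l j) = (\<Sum>k\<le>j. a i k * (\<Sum>l\<le>j. b k l * c l j))"
      by (simp add: sum_distrib_left mult.assoc)
  qed
  show zl: "0 + a = a" for a :: umat
    by transfer (auto simp: fun_eq_iff if_distrib[of "\<lambda>x. x * _"] cong: if_cong)
  show zr: "a + 0 = a" for a :: umat
    by transfer (auto simp: fun_eq_iff if_distrib[of "\<lambda>x. _ * x"] cong: if_cong)
  have r: "a + - a = 0" for a :: umat
  proof (transfer, intro ext)
    fix m :: "nat \<Rightarrow> nat \<Rightarrow> real" and i j :: nat
    assume *: "(\<forall>i. m i i = 1) \<and> (\<forall>i j. j < i \<longrightarrow> m i j = 0)"
    consider "j < i" | "i = j" | "i < j" by linarith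
    then show "(\<Sum>l\<le>j. m i l * uinv m l j) = (if i = j then 1 else 0)"
    proof cases
      case 1
      then show ?thesis using * by (auto intro!: sum.neutral)
    next
      case 2
      then show ?thesis using * by (subst sum_atMost_split_upper[of i]) (auto simp: uinv.simps)
    next
      case 3
      then have "(\<Sum>l\<le>j. m i l * uinv m l j) = uinv m i j + (\<Sum>l\<in>{i<..j}. m i l * uinv m l j)"
        using * by (subst sum_atMost_split_upper[of i]) auto
      then show ?thesis
        using 3 by (subst (asm) (2) uinv.simps) simp
    qed
  qed
  \<comment> \<open>Right inverses for all elements give left inverses: insert the right inverse of
    \<open>- a\<close>.\<close>
  have "- a + a = - a + a + (- a + - (- a))" by (simp add: r zr)
  also have "\<dots> = - a + (a + - a) + - (- a)" by (simp only: assoc)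
  also have "\<dots> = 0" by (simp only: r zr)
  finally show "- a + a = 0" .
  show "a + - b = a - b" by (simp add: minus_umat_def)
qed

end

lemma ent_diag [simp]: "ent m i i = 1"
  using ent[of m] by simp

lemma ent_lower [simp]: "j < i \<Longrightarrow> ent m i j = 0"
  using ent[of m] by simp

lemma ent_zero: "ent 0 i j = (if i = j then 1 else 0)"
  by transfer simp

lemma ent_plus: "ent (m + n) i j = (\<Sum>l\<le>j. ent m i l * ent n l j)"
  by transfer simp

lemma umat_eqI: "(\<And>i j. i < j \<Longrightarrow> ent m i j = ent n i j) \<Longrightarrow> m = n"
  by (metis ent_inject ent_diag ent_lower ext linorder_neqE_nat)

text \<open>\<open>deep k\<close> is the \<open>k\<close>-th term of the filtration by superdiagonals, a central series.\<close>

definition deep :: "nat \<Rightarrow> umat \<Rightarrow> bool" where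
  "deep k m \<longleftrightarrow> (\<forall>i j. i < j \<and> j < i + k \<longrightarrow> ent m i j = 0)"

text \<open>In the product sum the entries of \<open>m\<close> strictly between \<open>i\<close> and
  \<open>j\<close> vanish, so only the two terms at the ends remain.\<close>

lemma ent_plus_deep_left:
  assumes "deep k m" "i < j" "j \<le> i + k" shows "ent (m + n) i j = ent m i j + ent n i j"
proof -
  have "ent (m + n) i j = ent n i j + (\<Sum>l\<in>{i<..j}. ent m i l * ent n l j)"
    unfolding ent_plus using assms by (subst sum_atMost_split_upper[of i]) auto
  also have "(\<Sum>l\<in>{i<..j}. ent m i l * ent n l j) = (\<Sum>l\<in>{i<..j}. if l = j then ent m i j else 0)"
    using assms by (intro sum.cong) (auto simp: deep_def)
  finally show ?thesis using assms by simp
qed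

lemma ent_plus_deep_right:
  assumes "deep k n" "i < j" "j \<le> i + k" shows "ent (m + n) i j = ent m i j + ent n i j"
proof -
  have "ent (m + n) i j = ent n i j + (\<Sum>l\<in>{i<..j}. ent m i l * ent n l j)"
    unfolding ent_plus using assms by (subst sum_atMost_split_upper[of i]) auto
  also have "(\<Sum>l\<in>{i<..j}. ent m i l * ent n l j) = (\<Sum>l\<in>{i<..j}. if l = j then ent m i j else 0)"
    using assms by (intro sum.cong) (auto simp: deep_def)
  finally show ?thesis using assms by simp
qed

lemma deep_plus: "deep k m \<Longrightarrow> deep k n \<Longrightarrow> deep k (m + n)"
  unfolding deep_def using ent_plus_deep_left[of k m _ _ n] by (simp add: deep_def)

text \<open>Both sides of \<open>m + p = p + (- p + m + p)\<close> are expanded additively. For the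
  right side the conjugate must already be known to be deep, which is proved one superdiagonal at a
  time.\<close>

lemma ent_conj_deep:
  assumes "deep k m" "i < j" "j \<le> i + k" shows "ent (- p + m + p) i j = ent m i j"
proof -
  have "ent (m + p) i j = ent (p + (- p + m + p)) i j"
    by (simp add: add.assoc[symmetric])
  moreover have "deep k (- p + m + p)"
  proof -
    have "j < i + k \<Longrightarrow> i < j \<Longrightarrow> ent (- p + m + p) i j = 0" for i j
    proof (induction "j - i" arbitrary: i j rule: less_induct)
      case less
      have "deep (j - i) (- p + m + p)"
        unfolding deep_def
      proof (intro allI impI)
        fix i' j' assume "i' < j' \<and> j' < i' + (j - i)"
        with less.prems show "ent (- p + m + p) i' j' = 0"
          by (intro less.hyps) auto
      qed
      then have "ent (p + (- p + m + p)) i j = ent p i j + ent (- p + m + p) i j"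
        using less.prems by (intro ent_plus_deep_right) auto
      moreover have "ent (m + p) i j = ent m i j + ent p i j"
        using assms(1) less.prems by (intro ent_plus_deep_left) auto
      moreover have "ent m i j = 0"
        using assms(1) less.prems by (auto simp: deep_def)
      ultimately show ?case by (simp add: add.assoc[symmetric])
    qed
    then show ?thesis by (auto simp: deep_def)
  qed
  ultimately show ?thesis
    using ent_plus_deep_left[OF assms, of p] ent_plus_deep_right[of k "- p + m + p" i j p] assms
    by simp
qed

text \<open>Deleting the first row and column is an endomorphism. It brings any entry into row 0
  while turning solutions into solutions and homomorphisms into homomorphisms.\<close>

lift_definition ushift :: "umat \<Rightarrow> umat" is "\<lambda>m i j. m (Suc i) (Suc j)" by simp

lemma ent_ushift_funpow: "ent ((ushift ^^ n) m) i j = ent m (i + n) (j + n)"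
  by (induction n arbitrary: i j) (simp_all add: ushift.rep_eq)

lemma ushift_plus: "ushift (m + n) = ushift m + ushift n"
proof (rule umat_eqI)
  fix i j
  have "ent (ushift (m + n)) i j = (\<Sum>l\<le>Suc j. ent m (Suc i) l * ent n l (Suc j))"
    by (simp only: ushift.rep_eq ent_plus)
  also have "\<dots> = (\<Sum>l\<le>j. ent m (Suc i) (Suc l) * ent n (Suc l) (Suc j))"
    by (subst sum.atMost_Suc_shift) simp
  finally show "ent (ushift (m + n)) i j = ent (ushift m + ushift n) i j"
    by (simp add: ushift.rep_eq ent_plus)
qed

lemma ushift_funpow_plus: "(ushift ^^ k) (m + n) = (ushift ^^ k) m + (ushift ^^ k) n"
  by (induction k) (simp_all add: ushift_plus)

section \<open>A truncated Magnus representation of the free group\<close>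

lift_definition jmat :: "(nat \<Rightarrow> real) \<Rightarrow> umat" is
  "\<lambda>\<phi> i j. if i = j then 1 else if j = Suc i then \<phi> i else 0" by simp

lemma ent_plus_jmat:
  "ent (m + jmat \<phi>) i j = ent m i j + (if j = 0 then 0 else ent m i (j - 1) * \<phi> (j - 1))"
proof -
  have "ent (m + jmat \<phi>) i j =
    (\<Sum>l\<le>j. (if l = j then ent m i l else 0) + (if Suc l = j then ent m i l * \<phi> l else 0))"
    unfolding ent_plus jmat.rep_eq by (intro sum.cong) auto
  also have "\<dots> = ent m i j + (\<Sum>l\<le>j. (if Suc l = j then ent m i l * \<phi> l else 0))"
    by (simp add: sum.distrib)
  also have "(\<Sum>l\<le>j. (if Suc l = j then ent m i l * \<phi> l else 0)) = (if j = 0 then 0 else ent m i (j - 1) * \<phi> (j - 1))"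
    by (cases j) auto
  finally show ?thesis .
qed

text \<open>The hypothesis says that the superdiagonal part squares to zero, so the inverse of 1 + N
  is 1 - N.\<close>

lemma uminus_jmat:
  assumes "\<And>i. \<phi> i * \<phi> (Suc i) = 0"
  shows "- jmat \<phi> = jmat (\<lambda>i. - \<phi> i)"
proof -
  have "jmat \<phi> + jmat (\<lambda>i. - \<phi> i) = 0"
  proof (rule umat_eqI)
    fix i j :: nat assume "i < j"
    then show "ent (jmat \<phi> + jmat (\<lambda>i. - \<phi> i)) i j = ent 0 i j"
      using assms[of i] by (cases j) (auto simp: ent_plus_jmat jmat.rep_eq ent_zero)
  qed
  then show ?thesis by (simp add: minus_unique)
qed

text \<open>Superdiagonal positions are labelled by generators. Separating equal labels makes the
  nilpotent part of every \<open>mgen X x\<close> square to zero.\<close>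

definition adm :: "(nat \<Rightarrow> 'x option) \<Rightarrow> bool" where
  "adm X \<longleftrightarrow> (\<forall>i x. X i = Some x \<longrightarrow> X (Suc i) \<noteq> Some x)"

definition mgen :: "(nat \<Rightarrow> 'x option) \<Rightarrow> 'x \<Rightarrow> umat" where
  "mgen X x = jmat (\<lambda>i. if X i = Some x then 1 else 0)"

definition mlet :: "(nat \<Rightarrow> 'x option) \<Rightarrow> bool \<times> 'x \<Rightarrow> umat" where
  "mlet X c = jmat (\<lambda>i. if X i = Some (snd c) then (if fst c then 1 else - 1) else 0)"

lemma fhom_mgen:
  assumes "adm X"
  shows "fhom (mgen X) (lword w) = sum_list (map (mlet X) w)"
proof -
  have "- mgen X x = jmat (\<lambda>i. - (if X i = Some x then 1 else 0))" for x
    unfolding mgen_def by (rule uminus_jmat) (use assms in \<open>auto simp: adm_def\<close>)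
  then have "fhom (mgen X) (fletter c) = mlet X c" for c
    by (auto simp: fhom_fletter mlet_def mgen_def if_distrib[of uminus] cong: if_cong)
  then show ?thesis by (induction w) simp_all
qed

text \<open>Row \<open>0\<close> of the image of a word walks along the runs of equal letters: run number \<open>r\<close> is the
  only one that can use the step from \<open>r\<close> to \<open>r + 1\<close>, and steps of the same run add up with
  equal sign.\<close>

lemma magnus_walk:
  fixes w :: "(bool \<times> 'x) list"
  assumes "reduced w" "w \<noteq> []"
  shows "\<exists>X r. X r = Some (snd (last w)) \<and> (\<forall>i<r. \<forall>x. X i = Some x \<longrightarrow> X (Suc i) \<noteq> Some x) \<and>
    (\<forall>Y. (\<forall>i\<le>r. Y i = X i) \<and> adm Y \<longrightarrow>
      (\<forall>j>Suc r. ent (sum_list (map (mlet Y) w)) 0 j = 0) \<and>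
      (if fst (last w) then 1 else - 1) * ent (sum_list (map (mlet Y) w)) 0 (Suc r)
         * ent (sum_list (map (mlet Y) w)) 0 r > 0)"
  using assms
proof (induction w rule: rev_induct)
  case Nil
  then show ?case by simp
next
  case (snoc c w)
  show ?case
  proof (cases "w = []")
    case True
    then show ?thesis
      by (intro exI[of _ "\<lambda>_. Some (snd c)"] exI[of _ 0]) (auto simp: mlet_def jmat.rep_eq)
  next
    case False
    have red: "reduced w" "c \<noteq> linv (last w)"
      using snoc.prems False by (auto simp: successively_append_iff)
    obtain X r where X: "X r = Some (snd (last w))"
        "\<forall>i<r. \<forall>x. X i = Some x \<longrightarrow> X (Suc i) \<noteq> Some x"
      and IH: "\<And>Y. (\<forall>i\<le>r. Y i = X i) \<and> adm Y \<Longrightarrow>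
      (\<forall>j>Suc r. ent (sum_list (map (mlet Y) w)) 0 j = 0) \<and>
      (if fst (last w) then 1 else - 1) * ent (sum_list (map (mlet Y) w)) 0 (Suc r)
         * ent (sum_list (map (mlet Y) w)) 0 r > 0"
      using snoc.IH[OF red(1) False] by blast
    let ?v = "\<lambda>Y. ent (sum_list (map (mlet Y) w)) 0"
    let ?v' = "\<lambda>Y. ent (sum_list (map (mlet Y) w) + mlet Y c) 0"
    have v': "?v' Y j = ?v Y j + (if j = 0 then 0 else ?v Y (j - 1) *
       (if Y (j - 1) = Some (snd c) then (if fst c then 1 else - 1) else 0))" for Y j
      by (simp add: ent_plus_jmat mlet_def)
    show ?thesis
    proof (cases "snd c = snd (last w)")
      case True
      \<comment> \<open>A letter with the same generator as its predecessor in a reduced word equals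
        it, so the current run continues with the same sign.\<close>
      with red(2) have c: "c = last w" by (auto simp: prod_eq_iff linv_def)
      have "(\<forall>j>Suc r. ?v' Y j = 0) \<and>
         (if fst (last (w @ [c])) then 1 else - 1) * ?v' Y (Suc r) * ?v' Y r > 0"
        if Y: "(\<forall>i\<le>r. Y i = X i) \<and> adm Y" for Y
      proof -
        have Yr: "Y r = Some (snd c)" using Y X c by simp
        have Yr1: "Y (Suc r) \<noteq> Some (snd c)" using Y Yr by (auto simp: adm_def)
        have Yr2: "Y (r - 1) \<noteq> Some (snd c)" if "r > 0"
          using Y Yr that unfolding adm_def by (metis Suc_pred')
        have a: "?v' Y r = ?v Y r" using Yr2 by (auto simp: v')
        have b: "?v' Y (Suc r) = ?v Y (Suc r) + ?v Y r * (if fst c then 1 else - 1)"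
          using Yr by (simp add: v')
        have "?v' Y j = 0" if "j > Suc r" for j
        proof (cases "j = Suc (Suc r)")
          case True
          then show ?thesis using IH[OF Y] Yr1 by (auto simp: v')
        next
          case False
          then have "j - 1 > Suc r" using that by simp
          then show ?thesis using IH[OF Y] that by (auto simp: v')
        qed
        \<comment> \<open>One more letter of the run adds a square to the signed product, so no
          cancellation can occur.\<close>
        moreover have "(if fst c then 1 else - 1) * ?v' Y (Suc r) * ?v' Y r
           = (if fst c then 1 else - 1) * ?v Y (Suc r) * ?v Y r + ?v Y r * ?v Y r"
          unfolding a b by (simp add: algebra_simps)
        moreover have "(if fst c then 1 else - 1) * ?v Y (Suc r) * ?v Y r + ?v Y r * ?v Y r > 0"
          using IH[OF Y] c by (intro add_pos_nonneg) auto
        ultimately show ?thesis using c by simp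
      qed
      then show ?thesis using X c by (intro exI[of _ X] exI[of _ r]) auto
    next
      case False
      \<comment> \<open>A new generator opens run \<open>r + 1\<close>. The induction hypothesis
        fixes labels only up to \<open>r\<close>, which leaves this one to be chosen.\<close>
      let ?X = "X(Suc r := Some (snd c))"
      have "(\<forall>j>Suc (Suc r). ?v' Y j = 0) \<and>
         (if fst (last (w @ [c])) then 1 else - 1) * ?v' Y (Suc (Suc r)) * ?v' Y (Suc r) > 0"
        if Y: "(\<forall>i\<le>Suc r. Y i = ?X i) \<and> adm Y" for Y
      proof -
        have Y': "(\<forall>i\<le>r. Y i = X i) \<and> adm Y"
          using Y by (metis fun_upd_other le_SucI not_less_eq_eq order_refl)
        have Yr: "Y (Suc r) = Some (snd c)" using Y by simp
        have Yr1: "Y r \<noteq> Some (snd c)" using Y' X False by auto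
        have z: "?v Y j = 0" if "j > Suc r" for j using IH[OF Y'] that by blast
        have a: "?v' Y (Suc r) = ?v Y (Suc r)" using Yr1 by (simp add: v')
        have b: "?v' Y (Suc (Suc r)) = ?v Y (Suc r) * (if fst c then 1 else - 1)"
          using Yr z by (simp add: v')
        have nz: "?v Y (Suc r) \<noteq> 0" using IH[OF Y'] by auto
        have "(if fst c then 1 else - 1) * ?v' Y (Suc (Suc r)) * ?v' Y (Suc r)
           = ?v Y (Suc r) * ?v Y (Suc r)"
          unfolding a b by simp
        moreover have "?v Y (Suc r) * ?v Y (Suc r) > 0" using nz
          by (metis not_real_square_gt_zero)
        moreover have "?v' Y j = 0" if "j > Suc (Suc r)" for j
          using z that by (auto simp: v')
        ultimately show ?thesis by auto
      qed
      then show ?thesis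
        using X False by (intro exI[of _ ?X] exI[of _ "Suc r"]) (auto simp: less_Suc_eq)
    qed
  qed
qed

lemma fg_residually_umat:
  fixes v :: "'x fg"
  assumes "v \<noteq> 0"
  obtains h :: "'x \<Rightarrow> umat" where "fhom h v \<noteq> 0"
proof -
  let ?w = "Rep_fg v"
  have "?w \<noteq> []" using assms by (metis lword_Rep lword_simps(1))
  then obtain X r where X: "X r = Some (snd (last ?w))"
     "\<forall>i<r. \<forall>x. X i = Some x \<longrightarrow> X (Suc i) \<noteq> Some x"
    and W: "\<And>Y. (\<forall>i\<le>r. Y i = X i) \<and> adm Y \<Longrightarrow>
      (if fst (last ?w) then 1 else - 1) * ent (sum_list (map (mlet Y) ?w)) 0 (Suc r)
         * ent (sum_list (map (mlet Y) ?w)) 0 r > 0"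
    using magnus_walk[of ?w] by auto
  \<comment> \<open>Labels beyond \<open>r\<close> are removed, which makes the labelling admissible
    everywhere.\<close>
  let ?Y = "\<lambda>i. if i \<le> r then X i else None"
  have Y: "adm ?Y" using X(2) by (auto simp: adm_def)
  have "ent (sum_list (map (mlet ?Y) ?w)) 0 (Suc r) \<noteq> 0"
    using W[of ?Y] Y by auto
  then have "sum_list (map (mlet ?Y) ?w) \<noteq> 0" by (auto simp: ent_zero)
  then show ?thesis
    using that[of "mgen ?Y"] fhom_mgen[OF Y, of ?w] by simp
qed

section \<open>Words, and solutions of the relation\<close>

datatype bd = LB | LD

abbreviation bB :: "bd fg" where "bB \<equiv> fgen LB"
abbreviation bD :: "bd fg" where "bD \<equiv> fgen LD"

text \<open>The value \<open>f w\<close> stands for the conjugate of \<open>a\<close> by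
  \<open>w\<close>; the equation at \<open>w\<close> is the defining relation conjugated by
  \<open>w\<close>.\<close>

definition Sol :: "(bd fg \<Rightarrow> 'g::group_add) \<Rightarrow> bool" where
  "Sol f \<longleftrightarrow> (\<forall>w. f (bB + (bB + w)) - f (bB + w) + f w = - f (bD + (bD + w)) + f (bD + w) - f w)"

lemma Sol_comp:
  assumes "Sol f" "\<And>x y. \<phi> (x + y) = \<phi> x + \<phi> y"
  shows "Sol (\<lambda>x. \<phi> (f x))"
proof -
  note h = hom_uminus[of \<phi>, OF assms(2)]
  have "\<phi> (f (bB + (bB + w)) - f (bB + w) + f w) = \<phi> (- f (bD + (bD + w)) + f (bD + w) - f w)" for w
    using assms(1) by (simp only: Sol_def)
  from this[unfolded assms(2) h] show ?thesis unfolding Sol_def by blast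
qed

lemma Sol_translate: "Sol f \<Longrightarrow> Sol (\<lambda>x. f (x + u))"
  by (simp add: Sol_def add.assoc)

lemma group_add_solve:
  fixes p t x y z :: "'a::group_add"
  shows "t - (- p + t) = p" "x = x - y + z - z + y"
  by (simp_all only: diff_conv_add_uminus minus_add minus_minus add.assoc) simp_all

lemma Sol_solve_bb:
  assumes "Sol f"
  shows "f (bB + (bB + w)) = - f (bD + (bD + w)) + f (bD + w) - f w - f w + f (bB + w)"
proof -
  have "f (bB + (bB + w)) - f (bB + w) + f w = - f (bD + (bD + w)) + f (bD + w) - f w"
    using assms by (simp only: Sol_def)
  with group_add_solve(2)[of "f (bB + (bB + w))" "f (bB + w)" "f w"] show ?thesis by metis
qed

lemma Sol_iff_dd:
  "Sol f \<longleftrightarrow> (\<forall>w. f (bD + (bD + w)) = f (bD + w) - f w - (f (bB + (bB + w)) - f (bB + w) + f w))"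
proof -
  have "X = - p + y - z \<longleftrightarrow> p = y - z - X" for X p y z :: 'a
  proof
    assume "X = - p + y - z"
    then have "X = - p + (y - z)" by (simp add: add_diff_eq)
    then show "p = y - z - X" by (simp only: group_add_solve(1))
  next
    assume p: "p = y - z - X"
    have "- p + (y - z) = X" unfolding p
      by (simp add: diff_conv_add_uminus minus_add add.assoc del: add_uminus_conv_diff)
    then show "X = - p + y - z" by (simp add: add_diff_eq)
  qed
  then show ?thesis
    unfolding Sol_def by presburger
qed

lemma Sol_solve_dd:
  "Sol f \<Longrightarrow> f (bD + (bD + w)) = f (bD + w) - f w - (f (bB + (bB + w)) - f (bB + w) + f w)"
  by (simp only: Sol_iff_dd)

text \<open>The relation at \<open>w\<close> is solved for its term farthest from the origin, which is \<open>b b w\<close> or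
  \<open>d d w\<close> according to whether \<open>w\<close> starts with \<open>b\<inverse>\<close>; the remaining vertices are free.\<close>

definition isbb :: "(bool \<times> bd) list \<Rightarrow> bool" where
  "isbb x \<longleftrightarrow> take 2 x = [(True, LB), (True, LB)]"
definition isdd :: "(bool \<times> bd) list \<Rightarrow> bool" where
  "isdd x \<longleftrightarrow> take 3 x = [(True, LD), (True, LD), (False, LB)]"

abbreviation free_vertex :: "(bool \<times> bd) list \<Rightarrow> bool" where
  "free_vertex x \<equiv> \<not> isbb x \<and> \<not> isdd x"

lemma isbb_iff: "isbb x \<longleftrightarrow> (\<exists>w. x = (True, LB) # (True, LB) # w)"
  by (cases x; cases "tl x") (auto simp: isbb_def)

lemma isdd_iff: "isdd x \<longleftrightarrow> (\<exists>w. x = (True, LD) # (True, LD) # (False, LB) # w)"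
  by (cases x; cases "tl x"; cases "tl (tl x)") (auto simp: isdd_def numeral_3_eq_3)

text \<open>The second summand breaks ties of length: between the terms \<open>d d w\<close> and \<open>b b w\<close> of the
  relation, and between \<open>d v\<close> and \<open>d\<inverse> v\<close> in the construction of growing solutions below.\<close>

definition weight :: "(bool \<times> bd) list \<Rightarrow> nat" where
  "weight x = 2 * length x + (if take 1 x \<in> {[(True, LB)], [(False, LD)]} then 1 else 0)"

lemma length_lcons: "length (lcons c w) \<le> Suc (length w)"
  by (cases w) auto

lemma weight_lcons_less: "length w + 2 \<le> length x \<Longrightarrow> weight (lcons c w) < weight x"
  using length_lcons[of c w] by (auto simp: weight_def)

lemma weight_dd_less: "weight (lcons (True, LD) (lcons (t, LD) w)) < weight ((True, LB) # (True, LB) # w)"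
proof -
  consider "length (lcons (True, LD) (lcons (t, LD) w)) < length w + 2"
    | "lcons (True, LD) (lcons (t, LD) w) = (True, LD) # lcons (t, LD) w"
       "length (lcons (True, LD) (lcons (t, LD) w)) \<le> length w + 2"
  proof (cases "lcons (True, LD) (lcons (t, LD) w) = (True, LD) # lcons (t, LD) w")
    case False
    then have "length (lcons (True, LD) (lcons (t, LD) w)) < length (lcons (t, LD) w)"
      by (cases "lcons (t, LD) w") (auto split: if_splits)
    then show ?thesis using that(1) length_lcons[of "(t, LD)" w] by simp
  next
    case True
    then show ?thesis using that(2) length_lcons[of "(t, LD)" w] by simp
  qed
  then show ?thesis
    by cases (auto simp: weight_def)
qed

lemma weight_less: "length w < length x \<Longrightarrow> weight w < weight x"
  by (auto simp: weight_def)

text \<open>Both recursive branches solve the relation at \<open>w = tl (tl x)\<close>. In the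
  second one \<open>w\<close> starts with \<open>b\<inverse>\<close>, so
  \<open>tl (tl (tl x))\<close> is \<open>b w\<close> and one further letter \<open>b\<close> gives
  \<open>b b w\<close>.\<close>

function ext :: "((bool \<times> bd) list \<Rightarrow> 'g::group_add) \<Rightarrow> (bool \<times> bd) list \<Rightarrow> 'g" where
  "ext h x =
    (if isbb x then
       - ext h (lcons (True, LD) (lcons (True, LD) (tl (tl x)))) + ext h (lcons (True, LD) (tl (tl x)))
         - ext h (tl (tl x)) - ext h (tl (tl x)) + ext h (tl x)
     else if isdd x then
       ext h (tl x) - ext h (tl (tl x))
         - (ext h (lcons (True, LB) (tl (tl (tl x)))) - ext h (tl (tl (tl x))) + ext h (tl (tl x)))
     else h x)"
  by auto
termination
  by (relation "measure (\<lambda>(h, x). weight x)")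
     (auto simp: isbb_iff isdd_iff weight_dd_less weight_lcons_less weight_less)

declare ext.simps [simp del]

lemma ext_free: "free_vertex x \<Longrightarrow> ext h x = h x"
  by (simp add: ext.simps)

definition Ext :: "((bool \<times> bd) list \<Rightarrow> 'g::group_add) \<Rightarrow> bd fg \<Rightarrow> 'g" where
  "Ext h v = ext h (Rep_fg v)"

text \<open>If \<open>v\<close> begins with \<open>b\<inverse>\<close> then \<open>d d v\<close> is
  reduced and \<open>isdd\<close>, otherwise \<open>b b v\<close> is reduced and
  \<open>isbb\<close>. In either case the relation at \<open>v\<close> is a clause of the
  recursion.\<close>

lemma Sol_Ext: "Sol (Ext h)"
  unfolding Sol_iff_dd
proof
  fix v :: "bd fg"
  let ?w = "Rep_fg v"
  show "Ext h (bD + (bD + v)) = Ext h (bD + v) - Ext h v -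
      (Ext h (bB + (bB + v)) - Ext h (bB + v) + Ext h v)"
  proof (cases "\<exists>w. ?w = (False, LB) # w")
    case True
    then obtain w where w: "?w = (False, LB) # w" by blast
    have "isdd ((True, LD) # (True, LD) # ?w)" "\<not> isbb ((True, LD) # (True, LD) # ?w)"
      using w by (auto simp: isdd_iff isbb_iff)
    then show ?thesis
      by (simp add: Ext_def Rep_fletter_plus w ext.simps[of h "(True, LD) # (True, LD) # _"])
  next
    case False
    then have "lcons (True, LB) ?w = (True, LB) # ?w"
      by (cases ?w) auto
    moreover have "isbb ((True, LB) # (True, LB) # ?w)" by (simp add: isbb_iff)
    ultimately have "Ext h (bB + (bB + v)) =
       - Ext h (bD + (bD + v)) + Ext h (bD + v) - Ext h v - Ext h v + Ext h (bB + v)"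
      by (simp add: Ext_def Rep_fletter_plus ext.simps[of h "(True, LB) # (True, LB) # _"])
    then show ?thesis
      by (simp add: diff_diff_eq2 algebra_simps)
  qed
qed

lemma Ext_free: "free_vertex (Rep_fg v) \<Longrightarrow> Ext h v = h (Rep_fg v)"
  by (simp add: Ext_def ext_free)

text \<open>Together with \<open>Sol_Ext\<close> this identifies solutions with arbitrary functions
  on the free vertices, which is the freeness of the kernel.\<close>

lemma Sol_unique:
  assumes "Sol f" "Sol f'" "\<And>v. free_vertex (Rep_fg v) \<Longrightarrow> f v = f' v"
  shows "f = f'"
proof
  fix v show "f v = f' v"
  proof (induction "weight (Rep_fg v)" arbitrary: v rule: less_induct)
    case less
    consider "free_vertex (Rep_fg v)" | "isbb (Rep_fg v)" | "isdd (Rep_fg v)" by blast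
    then show ?case
    proof cases
      case 1 then show ?thesis by (rule assms(3))
    next
      case 2
      then obtain w where w: "Rep_fg v = (True, LB) # (True, LB) # w" by (auto simp: isbb_iff)
      define u where "u = lword w"
      have "reduced ((True, LB) # (True, LB) # w)" using w reduced_Rep by metis
      then have u: "Rep_fg u = w" "Rep_fg (bB + u) = (True, LB) # w"
        by (simp_all add: u_def Rep_lword Rep_fletter_plus reduced_Cons lcons_eq_Cons)
      have v: "v = bB + (bB + u)"
        using w by (metis lword_Rep lword_simps(2) u_def)
      have "f x = f' x" if "x \<in> {bD + (bD + u), bD + u, u, bB + u}" for x
      proof (rule less)
        show "weight (Rep_fg x) < weight (Rep_fg v)"
          using that u w by (auto simp: Rep_fletter_plus weight_dd_less weight_less weight_lcons_less)
      qed
      then show ?thesis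
        unfolding v using assms(1,2) by (simp add: Sol_solve_bb)
    next
      case 3
      then obtain w where w: "Rep_fg v = (True, LD) # (True, LD) # (False, LB) # w" by (auto simp: isdd_iff)
      define u where "u = lword ((False, LB) # w)"
      have "reduced ((True, LD) # (True, LD) # (False, LB) # w)" using w reduced_Rep by metis
      then have "Rep_fg u = (False, LB) # w"
        unfolding u_def by (intro Rep_lword) (auto simp: reduced_Cons)
      then have u: "Rep_fg u = (False, LB) # w" "Rep_fg (bD + u) = (True, LD) # (False, LB) # w"
         "Rep_fg (bB + u) = w"
        by (simp_all add: Rep_fletter_plus)
      have v: "v = bD + (bD + u)"
        using w by (metis lword_Rep lword_simps(2) u_def)
      have "f x = f' x" if "x \<in> {bD + u, u, bB + u, bB + (bB + u)}" for x
      proof (rule less)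
        show "weight (Rep_fg x) < weight (Rep_fg v)"
          using that u w by (auto simp: Rep_fletter_plus[of _ "_ + _"] weight_less weight_lcons_less)
      qed
      then show ?thesis
        unfolding v using assms(1,2) by (simp add: Sol_solve_dd)
    qed
  qed
qed

lemma Sol_eq_Ext: "Sol f \<Longrightarrow> f = Ext (\<lambda>x. f (lword x))"
  by (rule Sol_unique) (simp_all add: Sol_Ext Ext_free)

section \<open>Evaluation of words at solutions\<close>

fun letter_proj :: "letter \<Rightarrow> bd fg" where
  "letter_proj (s, Ga) = 0"
| "letter_proj (s, Gb) = fletter (s, LB)"
| "letter_proj (s, Gd) = fletter (s, LD)"

definition proj :: "letter list \<Rightarrow> bd fg" where
  "proj W = sum_list (map letter_proj W)"

lemma proj_simps [simp]:
  "proj [] = 0" "proj (c # W) = letter_proj c + proj W" "proj (V @ W) = proj V + proj W"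
  by (simp_all add: proj_def)

text \<open>A solution \<open>f\<close> makes \<open>G\<close> act on pairs \<open>(u, \<gamma>)\<close> by \<open>a (u, \<gamma>) = (u, f u + \<gamma>)\<close>,
  \<open>b (u, \<gamma>) = (b + u, \<gamma>)\<close> and \<open>d (u, \<gamma>) = (d + u, \<gamma>)\<close>; a word \<open>W\<close> maps \<open>(u, 0)\<close> to
  \<open>(proj W + u, val f W u)\<close>.\<close>

fun letter_val :: "(bd fg \<Rightarrow> 'g::group_add) \<Rightarrow> letter \<Rightarrow> bd fg \<Rightarrow> 'g" where
  "letter_val f (s, Ga) u = (if s then f u else - f u)"
| "letter_val f (s, Gb) u = 0"
| "letter_val f (s, Gd) u = 0"

fun val :: "(bd fg \<Rightarrow> 'g::group_add) \<Rightarrow> letter list \<Rightarrow> bd fg \<Rightarrow> 'g" where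
  "val f [] u = 0"
| "val f (c # W) u = letter_val f c (proj W + u) + val f W u"

lemma val_append: "val f (V @ W) u = val f V (proj W + u) + val f W u"
  by (induction V) (simp_all add: add.assoc)

lemma val_translate: "val f W (v + u) = val (\<lambda>x. f (x + u)) W v"
proof -
  have "letter_val f c (v + u) = letter_val (\<lambda>x. f (x + u)) c v" for c v
    by (cases c; cases "snd c") auto
  then show ?thesis by (induction W) (simp_all add: add.assoc[symmetric])
qed

lemma val_comp:
  assumes "\<And>x y. \<phi> (x + y) = \<phi> x + \<phi> y"
  shows "val (\<lambda>x. \<phi> (f x)) W u = \<phi> (val f W u)"
proof -
  have "letter_val (\<lambda>x. \<phi> (f x)) c u = \<phi> (letter_val f c u)" for c u
    by (cases c; cases "snd c") (auto simp: hom_uminus[of \<phi>, OF assms])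
  then show ?thesis by (induction W) (simp_all add: assms hom_uminus[of \<phi>, OF assms])
qed

lemma word_eq_invariants:
  assumes "word_eq V W"
  shows "proj V = proj W" "Sol f \<Longrightarrow> val f V u = val f W u"
proof -
  have "proj V = proj W \<and> (Sol f \<longrightarrow> (\<forall>u. val f V u = val f W u))"
    using assms
  proof induction
    case (cancel u s x v)
    have "letter_proj (s, x) + (letter_proj (\<not> s, x) + t) = t" for t
      by (cases s; cases x) simp_all
    moreover have "letter_val f (s, x) (letter_proj (\<not> s, x) + t) + (letter_val f (\<not> s, x) t + c) = c" for t c
      by (cases s; cases x) (simp_all add: add.assoc[symmetric])
    ultimately show ?case
      by (simp add: val_append add.assoc)
  next
    case (relator u v)
    have p: "proj rel_lhs + t = t" "proj rel_rhs + t = t" for t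
      by (simp_all add: rel_lhs_def rel_rhs_def pos_def neg_def add.assoc)
    have "val f rel_lhs t = f (bB + (bB + t)) - f (bB + t) + f t" for t
      by (simp add: rel_lhs_def pos_def neg_def add.assoc diff_conv_add_uminus
          del: add_uminus_conv_diff)
    moreover have "val f rel_rhs t = - f (bD + (bD + t)) + f (bD + t) - f t" for t
      by (simp add: rel_rhs_def pos_def neg_def add.assoc diff_conv_add_uminus
          del: add_uminus_conv_diff)
    ultimately have "Sol f \<Longrightarrow> val f rel_lhs t = val f rel_rhs t" for t
      by (simp add: Sol_def)
    then show ?case by (simp add: val_append p add.assoc)
  qed auto
  then show "proj V = proj W" "Sol f \<Longrightarrow> val f V u = val f W u" by auto
qed

section \<open>The one-relator group as a type of word classes\<close>

lemma word_eq_append_left: "word_eq v w \<Longrightarrow> word_eq (u @ v) (u @ w)"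
proof (induction rule: word_eq.induct)
  case (cancel a s x b)
  show ?case using word_eq.cancel[of "u @ a" s x b] by simp
next
  case (relator a b)
  show ?case using word_eq.relator[of "u @ a" b] by simp
next
  case (refl w)
  show ?case by (rule word_eq.refl)
next
  case (sym v w)
  from sym.IH show ?case by (rule word_eq.sym)
next
  case (trans a b c)
  from trans.IH show ?case by (rule word_eq.trans)
qed

lemma word_eq_append_right: "word_eq v w \<Longrightarrow> word_eq (v @ u) (w @ u)"
proof (induction rule: word_eq.induct)
  case (cancel a s x b)
  show ?case using word_eq.cancel[of a s x "b @ u"] by simp
next
  case (relator a b)
  show ?case using word_eq.relator[of a "b @ u"] by simp
next
  case (refl w)
  show ?case by (rule word_eq.refl)
next
  case (sym v w)
  from sym.IH show ?case by (rule word_eq.sym)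
next
  case (trans a b c)
  from trans.IH show ?case by (rule word_eq.trans)
qed

lemma word_eq_append: "word_eq v v' \<Longrightarrow> word_eq w w' \<Longrightarrow> word_eq (v @ w) (v' @ w')"
  by (meson word_eq.trans word_eq_append_left word_eq_append_right)

abbreviation winv :: "letter list \<Rightarrow> letter list" where
  "winv w \<equiv> rev (map linv w)"

lemma word_eq_winv_left: "word_eq (winv w @ w) []"
proof (induction w)
  case Nil show ?case by (simp add: word_eq.refl)
next
  case (Cons c w)
  have "word_eq (winv w @ [linv c, c] @ w) (winv w @ w)"
    using word_eq.cancel[of "winv w" "\<not> fst c" "snd c" w] by (simp add: linv_def)
  from word_eq.trans[OF this Cons] show ?case by simp
qed

lemma word_eq_winv_right: "word_eq (w @ winv w) []"
  using word_eq_winv_left[of "winv w"] by (simp add: rev_map comp_def)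

lemma word_eq_winv:
  assumes "word_eq v w"
  shows "word_eq (winv v) (winv w)"
proof -
  have 1: "word_eq (winv v) (winv v @ w @ winv w)"
    using word_eq_append_left[OF word_eq.sym[OF word_eq_winv_right], of "winv v" w] by simp
  have 2: "word_eq (winv v @ w @ winv w) (winv v @ v @ winv w)"
    by (rule word_eq_append_left, rule word_eq_append_right, rule word_eq.sym[OF assms])
  have 3: "word_eq (winv v @ v @ winv w) (winv w)"
    using word_eq_append_right[OF word_eq_winv_left[of v], of "winv w"] by simp
  show ?thesis by (rule word_eq.trans[OF 1 word_eq.trans[OF 2 3]])
qed

quotient_type grp = "letter list" / word_eq
proof (intro equivpI reflpI sympI transpI)
  show "word_eq w w" for w by (rule word_eq.refl)
  show "word_eq v w \<Longrightarrow> word_eq w v" for v w by (rule word_eq.sym)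
  show "word_eq u v \<Longrightarrow> word_eq v w \<Longrightarrow> word_eq u w" for u v w by (rule word_eq.trans)
qed

instantiation grp :: group_add
begin

lift_definition zero_grp :: grp is "[]" .
lift_definition plus_grp :: "grp \<Rightarrow> grp \<Rightarrow> grp" is append by (rule word_eq_append)
lift_definition uminus_grp :: "grp \<Rightarrow> grp" is winv by (rule word_eq_winv)
definition minus_grp :: "grp \<Rightarrow> grp \<Rightarrow> grp" where "minus_grp x y = x + - y"

instance
proof
  fix a b c :: grp
  show "a + b + c = a + (b + c)" by transfer (simp add: word_eq.refl)
  show "0 + a = a" by transfer (simp add: word_eq.refl)
  show "a + 0 = a" by transfer (simp add: word_eq.refl)
  show "- a + a = 0" by transfer (rule word_eq_winv_left)
  show "a + - b = a - b" by (simp add: minus_grp_def)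
qed

end

lemma abs_grp_append: "abs_grp (v @ w) = abs_grp v + abs_grp w"
  by (simp add: plus_grp.abs_eq)

lemma abs_grp_Cons: "abs_grp (c # w) = abs_grp [c] + abs_grp w"
  using abs_grp_append[of "[c]" w] by simp

lemma abs_grp_eq_iff: "abs_grp v = abs_grp w \<longleftrightarrow> word_eq v w"
  by (rule grp.abs_eq_iff)

lemma abs_grp_Nil [simp]: "abs_grp [] = 0"
  by (simp add: zero_grp_def)

lemma abs_grp_neg: "abs_grp [(False, x)] = - abs_grp [(True, x)]"
  by (simp add: uminus_grp.abs_eq)

abbreviation grp_gen :: "gen \<Rightarrow> grp" where "grp_gen x \<equiv> abs_grp [(True, x)]"

lemma grp_relation:
  defines "a \<equiv> grp_gen Ga" and "b \<equiv> grp_gen Gb" and "d \<equiv> grp_gen Gd"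
  shows "- b + (- b + (a + (b + (- a + (b + a))))) = - d + (- d + (- a + (d + (a + (d + - a)))))"
proof -
  have "abs_grp rel_lhs = abs_grp rel_rhs"
    using word_eq.relator[of "[]" "[]"] by (simp add: abs_grp_eq_iff)
  then show ?thesis
    unfolding rel_lhs_def rel_rhs_def pos_def neg_def a_def b_def d_def
    by (simp add: abs_grp_Cons[of _ "_ # _"] abs_grp_neg)
qed

definition lift_bd :: "bd fg \<Rightarrow> grp" where
  "lift_bd = fhom (\<lambda>x. case x of LB \<Rightarrow> grp_gen Gb | LD \<Rightarrow> grp_gen Gd)"

text \<open>The tautological solution, with values in the group itself.\<close>

definition conj_a :: "bd fg \<Rightarrow> grp" where
  "conj_a v = - lift_bd v + grp_gen Ga + lift_bd v"

lemma lift_bd_simps [simp]: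
  "lift_bd 0 = 0" "lift_bd (u + v) = lift_bd u + lift_bd v"
  "lift_bd (fletter (s, LB)) = abs_grp [(s, Gb)]" "lift_bd (fletter (s, LD)) = abs_grp [(s, Gd)]"
  by (cases s; simp add: lift_bd_def fhom_fletter abs_grp_neg)+

lemma Sol_conj_a: "Sol conj_a"
  unfolding Sol_def
proof
  fix w :: "bd fg"
  let ?a = "grp_gen Ga" and ?b = "grp_gen Gb" and ?d = "grp_gen Gd" and ?s = "lift_bd w"
  have "conj_a (bB + (bB + w)) - conj_a (bB + w) + conj_a w
     = - ?s + (- ?b + (- ?b + (?a + (?b + (- ?a + (?b + ?a)))))) + ?s"
    by (simp add: conj_a_def add.assoc minus_add diff_conv_add_uminus del: add_uminus_conv_diff)
  also have "\<dots> = - ?s + (- ?d + (- ?d + (- ?a + (?d + (?a + (?d + - ?a)))))) + ?s"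
    by (simp only: grp_relation)
  also have "\<dots> = - conj_a (bD + (bD + w)) + conj_a (bD + w) - conj_a w"
    by (simp add: conj_a_def add.assoc minus_add diff_conv_add_uminus del: add_uminus_conv_diff)
  finally show "conj_a (bB + (bB + w)) - conj_a (bB + w) + conj_a w
    = - conj_a (bD + (bD + w)) + conj_a (bD + w) - conj_a w" .
qed

text \<open>\<open>lift_bd\<close> splits the projection, and the value at the tautological solution
  is the kernel part. For \<open>proj W = 0\<close> and \<open>u = 0\<close> the word is recovered
  from that value.\<close>

lemma abs_grp_val: "abs_grp W + lift_bd u = lift_bd (proj W + u) + val conj_a W u"
proof (induction W)
  case Nil
  then show ?case by simp
next
  case (Cons c W)
  have *: "abs_grp [c] + lift_bd v = lift_bd (letter_proj c + v) + letter_val conj_a c v" for v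
  proof -
    have "lift_bd v + conj_a v = grp_gen Ga + lift_bd v"
      by (simp add: conj_a_def add.assoc)
    moreover have "lift_bd v + - conj_a v = - grp_gen Ga + lift_bd v"
      by (simp only: conj_a_def minus_add minus_minus add.assoc add_minus_cancel)
    ultimately show ?thesis
      by (cases "(conj_a, c, v)" rule: letter_val.cases) (auto simp: abs_grp_neg)
  qed
  have "abs_grp (c # W) + lift_bd u = abs_grp [c] + (abs_grp W + lift_bd u)"
    by (simp only: abs_grp_Cons[of c W] add.assoc)
  also have "\<dots> = (abs_grp [c] + lift_bd (proj W + u)) + val conj_a W u"
    by (simp only: Cons add.assoc)
  also have "\<dots> = lift_bd (proj (c # W) + u) + val conj_a (c # W) u"
    by (simp only: * proj_simps val.simps add.assoc)
  finally show ?case .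
qed

lemma kernel_residually_umat:
  assumes "proj W = 0" "\<And>f :: bd fg \<Rightarrow> umat. Sol f \<Longrightarrow> val f W 0 = 0"
  shows "abs_grp W = 0"
proof -
  \<comment> \<open>The universal solution: independent generators of a free group at the free
    vertices.\<close>
  define U :: "bd fg \<Rightarrow> (bool \<times> bd) list fg" where "U = Ext fgen"
  have U: "Sol U" by (simp add: U_def Sol_Ext)
  have "val U W 0 = 0"
  proof (rule ccontr)
    assume "val U W 0 \<noteq> 0"
    then obtain h :: "(bool \<times> bd) list \<Rightarrow> umat" where h: "fhom h (val U W 0) \<noteq> 0"
      by (rule fg_residually_umat)
    have "val (\<lambda>x. fhom h (U x)) W 0 = fhom h (val U W 0)"
      by (rule val_comp) simp
    moreover have "Sol (\<lambda>x. fhom h (U x))"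
      by (rule Sol_comp[OF U]) simp
    ultimately show False using assms(2)[of "\<lambda>x. fhom h (U x)"] h by simp
  qed
  let ?h = "\<lambda>x. conj_a (lword x)"
  \<comment> \<open>The tautological solution is a homomorphic image of the universal one, so
    vanishing of \<open>val U W 0\<close> carries over to it.\<close>
  have "conj_a = (\<lambda>x. fhom ?h (U x))"
  proof (rule Sol_unique[OF Sol_conj_a])
    show "Sol (\<lambda>x. fhom ?h (U x))" by (rule Sol_comp[OF U]) simp
  qed (simp add: U_def Ext_free)
  then have "val conj_a W 0 = val (\<lambda>x. fhom ?h (U x)) W 0"
    by (rule arg_cong[where f = "\<lambda>f. val f W 0"])
  also have "\<dots> = fhom ?h (val U W 0)"
    by (rule val_comp) simp
  finally have "val conj_a W 0 = 0" using \<open>val U W 0 = 0\<close> by simp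
  then show ?thesis using abs_grp_val[of W 0] assms(1) by simp
qed

section \<open>Cutting solutions along edges\<close>

text \<open>Words grow on the left, so having \<open>x0\<close> as a suffix means lying in the
  branch of the tree beyond \<open>x0\<close> as seen from the origin.\<close>

abbreviation desc :: "'x fg \<Rightarrow> 'x fg \<Rightarrow> bool" where
  "desc x0 x \<equiv> suffix (Rep_fg x0) (Rep_fg x)"

lemma desc_length_eq: "desc x0 x \<Longrightarrow> flen x \<le> flen x0 \<Longrightarrow> x = x0"
  by (auto simp: suffix_def Rep_fg_inject)

lemma list_has_maximal:
  fixes L :: "'b \<Rightarrow> nat"
  assumes "us \<noteq> []"
  obtains u0 where "u0 \<in> set us" "\<And>u. u \<in> set us \<Longrightarrow> L u \<le> L u0"
proof -
  have "Max (L ` set us) \<in> L ` set us" using assms by (intro Max_in) auto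
  then obtain u0 where "u0 \<in> set us" "L u0 = Max (L ` set us)" by auto
  then show ?thesis using that[of u0] by simp
qed

lemma fletter_linv_cancel [simp]:
  "fletter (linv c) + (fletter c + v) = v" "fletter c + (fletter (linv c) + v) = v"
  "fletter (linv c) + fletter c = 0" "fletter c + fletter (linv c) = 0"
  by (simp_all add: uminus_fletter[symmetric])

lemma Rep_fletter_plus_cases:
  obtains "Rep_fg (fletter c + x) = c # Rep_fg x"
  | "Rep_fg x = linv c # Rep_fg (fletter c + x)"
proof (cases "Rep_fg x")
  case Nil
  then show ?thesis using that(1) by (simp add: Rep_fletter_plus)
next
  case (Cons k w)
  then show ?thesis
    using that by (cases "k = linv c") (simp_all add: Rep_fletter_plus)
qed

context
  fixes c :: "bool \<times> 'x" and x0 y0 :: "'x fg"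
  assumes x0: "x0 = fletter c + y0" "Rep_fg x0 = c # Rep_fg y0"
begin

lemma cross_in:
  assumes "\<not> desc x0 x" "desc x0 (fletter k + x)"
  shows "k = c" "x = y0" "fletter k + x = x0"
proof -
  have "k # Rep_fg x = Rep_fg x0"
  proof (cases rule: Rep_fletter_plus_cases[of k x])
    case 1
    then show ?thesis using assms by (auto simp: suffix_Cons)
  next
    case 2
    then show ?thesis using assms by (metis suffix_ConsI)
  qed
  then show "k = c" "x = y0" "fletter k + x = x0"
    using x0 by (auto simp: Rep_fg_inject)
qed

lemma cross_out:
  assumes "desc x0 x" "\<not> desc x0 (fletter k + x)"
  shows "k = linv c" "x = x0" "fletter k + x = y0"
proof -
  have x: "x = x0 \<and> k = linv c"
  proof (cases rule: Rep_fletter_plus_cases[of k x])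
    case 1
    then show ?thesis using assms by (metis suffix_ConsI)
  next
    case 2
    then have "Rep_fg x = Rep_fg x0" using assms by (auto simp: suffix_Cons)
    then have "x = x0" by (simp add: Rep_fg_inject)
    moreover from this 2 x0 have "linv k = c" by simp
    ultimately show ?thesis using linv_linv[of k] by simp
  qed
  then show "k = linv c" "x = x0" "fletter k + x = y0"
    using x0 by auto
qed

text \<open>\<open>v1\<close> is the part of the path after its last entry into the branch. The
  entry goes through \<open>x0\<close> and uses up a letter, hence the strict inequality.\<close>

lemma walk_in:
  assumes "\<not> desc x0 u" "desc x0 (lword v + u)"
  shows "\<exists>v1. length v1 < length v \<and> lword v + u = lword v1 + x0"
  using assms(2)
proof (induction v)
  case Nil
  then show ?case using assms(1) by simp
next
  case (Cons k v)
  show ?case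
  proof (cases "desc x0 (lword v + u)")
    case True
    then obtain v1 where "length v1 < length v" "lword v + u = lword v1 + x0"
      using Cons.IH by blast
    then show ?thesis by (intro exI[of _ "k # v1"]) (simp add: add.assoc)
  next
    case False
    with Cons.prems have "fletter k + (lword v + u) = x0"
      using cross_in by (simp add: add.assoc)
    then show ?thesis by (intro exI[of _ "[]"]) (simp add: add.assoc)
  qed
qed

lemma walk_out:
  assumes "desc x0 u" "\<not> desc x0 (lword v + u)"
  shows "\<exists>v1. length v1 < length v \<and> lword v + u = lword v1 + y0"
  using assms(2)
proof (induction v)
  case Nil
  then show ?case using assms(1) by simp
next
  case (Cons k v)
  show ?case
  proof (cases "desc x0 (lword v + u)")
    case False
    then obtain v1 where "length v1 < length v" "lword v + u = lword v1 + y0"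
      using Cons.IH by blast
    then show ?thesis by (intro exI[of _ "k # v1"]) (simp add: add.assoc)
  next
    case True
    with Cons.prems have "fletter k + (lword v + u) = y0"
      using cross_out by (simp add: add.assoc)
    then show ?thesis by (intro exI[of _ "[]"]) (simp add: add.assoc)
  qed
qed

end

text \<open>The vertices occurring in the equation at \<open>t\<close>.\<close>

definition star :: "bd fg \<Rightarrow> bd fg set" where
  "star t = {t, bB + t, bB + (bB + t), bD + t, bD + (bD + t)}"

text \<open>Two neighbouring stars meet in two vertices, which separate the vertices on either side of
  the edge. \<open>sep0 c\<close> lists them relative to the endpoint whose first letter is \<open>c\<close>.\<close>

definition sep0 :: "bool \<times> bd \<Rightarrow> bd fg set" where
  "sep0 c = (if fst c then {0, fgen (snd c)} else {fgen (snd c), fgen (snd c) + fgen (snd c)})"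

definition sep :: "bool \<times> bd \<Rightarrow> bd fg \<Rightarrow> bd fg set" where
  "sep c x0 = (\<lambda>x. x + x0) ` sep0 c"

lemma Sol_on_star:
  "Sol f \<Longrightarrow> \<forall>y\<in>star t. g y = f y \<Longrightarrow>
    g (bB + (bB + t)) - g (bB + t) + g t = - g (bD + (bD + t)) + g (bD + t) - g t"
  by (simp add: star_def Sol_def)

lemma star_cases:
  assumes "y \<in> star t"
  obtains "y = t" | g where "y = fgen g + t" | g where "y = fgen g + (fgen g + t)"
  using assms unfolding star_def by blast

lemma star_gen: "t \<in> star t" "fgen g + t \<in> star t" "fgen g + (fgen g + t) \<in> star t"
  by (cases g; simp add: star_def)+

lemma star_translate: "y \<in> star t \<Longrightarrow> y + u \<in> star (t + u)"
  by (auto simp: star_def add.assoc)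

context
  fixes c :: "bool \<times> bd" and x0 y0 :: "bd fg"
  assumes x0: "x0 = fletter c + y0" "Rep_fg x0 = c # Rep_fg y0"
begin

lemma sep_conv: "sep c x0 = (if fst c then {x0, fgen (snd c) + x0} else {y0, fgen (snd c) + y0})"
proof (cases "fst c")
  case False
  then have "y0 = fgen (snd c) + x0"
    using x0(1) by (cases c) simp
  then show ?thesis using False by (auto simp: sep_def sep0_def add.assoc)
qed (auto simp: sep_def sep0_def)

lemma sep_subset_star: "sep c x0 \<subseteq> star x0" "sep c x0 \<subseteq> star y0"
proof -
  have "fst c \<Longrightarrow> x0 = fgen (snd c) + y0" "\<not> fst c \<Longrightarrow> y0 = fgen (snd c) + x0"
    using x0(1) by (cases c; simp)+
  then show "sep c x0 \<subseteq> star x0" "sep c x0 \<subseteq> star y0"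
    unfolding sep_conv using star_gen[where t = x0] star_gen[where t = y0] by (auto split: if_splits)
qed

lemma edge_sep:
  assumes "desc x0 x \<noteq> desc x0 (fgen g + x)"
  shows "fgen g + x \<in> sep c x0 \<and> fgen g + (fgen g + x) \<in> sep c x0"
proof (cases "desc x0 x")
  case True
  then have "linv c = (True, g)" "fgen g + x = y0"
    using cross_out[OF x0, of x "(True, g)"] assms by auto
  then have "\<not> fst c" "snd c = g" "fgen g + x = y0"
    by (auto simp: linv_def prod_eq_iff)
  then show ?thesis unfolding sep_conv by simp
next
  case False
  then have "fst c" "snd c = g" "fgen g + x = x0"
    using cross_in[OF x0, of x "(True, g)"] assms by auto
  then show ?thesis unfolding sep_conv by simp
qed

text \<open>When the path \<open>t\<close>, \<open>g t\<close>, \<open>g g t\<close> crosses the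
  edge, all its vertices after the crossing lie in the separator.\<close>

lemma star_sep:
  assumes "y \<in> star t" "desc x0 t \<noteq> desc x0 y" shows "y \<in> sep c x0"
  using assms(1)
proof (cases rule: star_cases)
  case (3 g)
  then show ?thesis
    using edge_sep[of t g] edge_sep[of "fgen g + t" g] assms(2) by auto
qed (use assms(2) edge_sep[of t] in auto)

text \<open>On each star the glued function coincides with one of the two solutions, namely the one
  used at the centre: vertices across the edge are separator vertices, where both agree.\<close>

lemma glue:
  assumes "Sol f" "Sol f'" "\<And>x. x \<in> sep c x0 \<Longrightarrow> f x = f' x"
  shows "Sol (\<lambda>x. if desc x0 x then f' x else f x)" (is "Sol ?g")
  unfolding Sol_def
proof
  fix t
  have "(\<forall>y\<in>star t. ?g y = f y) \<or> (\<forall>y\<in>star t. ?g y = f' y)"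
    using star_sep[of _ t] assms(3) by (cases "desc x0 t") auto
  then show "?g (bB + (bB + t)) - ?g (bB + t) + ?g t = - ?g (bD + (bD + t)) + ?g (bD + t) - ?g t"
    using Sol_on_star[OF assms(1), of t ?g] Sol_on_star[OF assms(2), of t ?g] by blast
qed

end

text \<open>The strict bound makes the ball of radius 0 empty and the ball of radius 1 a single
  star.\<close>

definition star_ball :: "nat \<Rightarrow> bd fg \<Rightarrow> bd fg set" where
  "star_ball r u = {y. \<exists>v. length v < r \<and> y \<in> star (lword v + u)}"

lemma star_ball_0 [simp]: "star_ball 0 u = {}"
  by (simp add: star_ball_def)

lemma star_subset_ball: "r > 0 \<Longrightarrow> star u \<subseteq> star_ball r u"
  unfolding star_ball_def by (auto intro!: exI[of _ "[]"])

lemma star_ball_mono: "r \<le> s \<Longrightarrow> star_ball r u \<subseteq> star_ball s u"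
  unfolding star_ball_def using less_le_trans by blast

lemma star_ball_step: "star_ball r (fletter k + u) \<subseteq> star_ball (Suc r) u"
proof
  fix y assume "y \<in> star_ball r (fletter k + u)"
  then obtain v where "length v < r" "y \<in> star (lword v + (fletter k + u))"
    by (auto simp: star_ball_def)
  then show "y \<in> star_ball (Suc r) u"
    unfolding star_ball_def by (auto intro!: exI[of _ "v @ [k]"] simp: add.assoc)
qed

lemma star_ball_translate: "y \<in> star_ball r t \<Longrightarrow> y + u \<in> star_ball r (t + u)"
  using star_translate by (fastforce simp: star_ball_def add.assoc[symmetric])

lemma star_ball_translate_iff: "y - u \<in> star_ball r t \<longleftrightarrow> y \<in> star_ball r (t + u)"
  using star_ball_translate[of "y - u" r t u] star_ball_translate[of y r "t + u" "- u"]
  by (auto simp: add.assoc)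

lemma sep_translate_iff: "y - x0 \<in> sep0 c \<longleftrightarrow> y \<in> sep c x0"
  by (force simp: sep_def)

context
  fixes c :: "bool \<times> bd" and x0 y0 :: "bd fg"
  assumes x0: "x0 = fletter c + y0" "Rep_fg x0 = c # Rep_fg y0"
begin

text \<open>One unit of radius is spent on reaching \<open>x0\<close>. Stars centred outside the
  branch reach into it only at the separator.\<close>

lemma star_ball_in:
  assumes "\<not> desc x0 u" "y \<in> star_ball (Suc r) u" "desc x0 y"
  shows "y \<in> star_ball r x0 \<union> sep c x0"
proof -
  obtain v where v: "length v < Suc r" "y \<in> star (lword v + u)"
    using assms(2) by (auto simp: star_ball_def)
  show ?thesis
  proof (cases "desc x0 (lword v + u)")
    case True
    then obtain v1 where "length v1 < length v" "lword v + u = lword v1 + x0"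
      using walk_in[OF x0 assms(1)] by blast
    with v have "length v1 < r" "y \<in> star (lword v1 + x0)" by simp_all
    then show ?thesis unfolding star_ball_def by blast
  next
    case False
    then show ?thesis using star_sep[OF x0 v(2)] assms(3) by auto
  qed
qed

lemma star_ball_out:
  assumes "desc x0 u" "y \<in> star_ball (Suc r) u" "\<not> desc x0 y"
  shows "y \<in> star_ball r y0 \<union> sep c x0"
proof -
  obtain v where v: "length v < Suc r" "y \<in> star (lword v + u)"
    using assms(2) by (auto simp: star_ball_def)
  show ?thesis
  proof (cases "desc x0 (lword v + u)")
    case False
    then obtain v1 where "length v1 < length v" "lword v + u = lword v1 + y0"
      using walk_out[OF x0 assms(1)] by blast
    with v have "length v1 < r" "y \<in> star (lword v1 + y0)" by simp_all
    then show ?thesis unfolding star_ball_def by blast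
  next
    case True
    then show ?thesis using star_sep[OF x0 v(2)] assms(3) by auto
  qed
qed

end

section \<open>Functionals whose translates sum to zero\<close>

definition det :: "((bd fg \<Rightarrow> 'g::group_add) \<Rightarrow> real) \<Rightarrow> bd fg set \<Rightarrow> bool" where
  "det z Q \<longleftrightarrow> (\<forall>f f'. Sol f \<longrightarrow> Sol f' \<longrightarrow> (\<forall>x\<in>Q. f x = f' x) \<longrightarrow> z f = z f')"

definition balanced :: "((bd fg \<Rightarrow> 'g::group_add) \<Rightarrow> real) \<Rightarrow> bd fg list \<Rightarrow> bool" where
  "balanced z us \<longleftrightarrow> (\<forall>f. Sol f \<longrightarrow> sum_list (map (\<lambda>u. z (\<lambda>x. f (x + u))) us) = 0)"

lemma balancedD: "balanced z us \<Longrightarrow> Sol f \<Longrightarrow> sum_list (map (\<lambda>u. z (\<lambda>x. f (x + u))) us) = 0"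
  by (auto simp: balanced_def)

lemma detD: "det z Q \<Longrightarrow> Sol f \<Longrightarrow> Sol f' \<Longrightarrow> (\<And>x. x \<in> Q \<Longrightarrow> f x = f' x) \<Longrightarrow> z f = z f'"
  unfolding det_def by blast

lemma sum_list_differ_at:
  fixes p q :: "'b \<Rightarrow> real"
  assumes "\<And>u. u \<in> set us \<Longrightarrow> u \<noteq> u0 \<Longrightarrow> p u = q u"
  shows "sum_list (map p us) = sum_list (map q us) + real (count_list us u0) * (p u0 - q u0)"
  using assms
proof (induction us)
  case (Cons u us)
  then have "sum_list (map p us) = sum_list (map q us) + real (count_list us u0) * (p u0 - q u0)"
    by simp
  then show ?case
    using Cons.prems[of u] by (cases "u = u0") (simp_all add: algebra_simps)
qed simp

text \<open>For \<open>f\<close> and \<open>f'\<close> agreeing on \<open>Q\<close>, glue their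
  translates by \<open>- u0\<close>, with \<open>f\<close> beyond the edge and \<open>f'\<close>
  elsewhere. By \<open>inside\<close> every summand with \<open>u \<noteq> u0\<close> is the same as
  for \<open>f'\<close> alone; both sums vanish, so the summand at \<open>u0\<close> is the same
  too. By \<open>out\<close> the glued solution looks like \<open>f\<close> through the window at
  \<open>u0\<close>.\<close>

lemma det_cut:
  assumes bal: "balanced z us" and u0: "u0 \<in> set us" and W: "det z W"
    and x0: "x0 = fletter c + y0" "Rep_fg x0 = c # Rep_fg y0"
    and s: "\<And>y. y \<in> sep c x0 \<Longrightarrow> y - u0 \<in> Q"
    and out: "\<And>x. x \<in> W \<Longrightarrow> \<not> desc x0 (x + u0) \<Longrightarrow> x \<in> Q"
    and inside: "\<And>u x. u \<in> set us \<Longrightarrow> u \<noteq> u0 \<Longrightarrow> x \<in> W \<Longrightarrow> desc x0 (x + u) \<Longrightarrow> x + u - u0 \<in> Q"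
  shows "det z Q"
  unfolding det_def
proof (intro allI impI)
  fix f f' :: "bd fg \<Rightarrow> 'a"
  assume f: "Sol f" "Sol f'" and eq: "\<forall>x\<in>Q. f x = f' x"
  let ?f = "\<lambda>x. f (x - u0)" and ?f' = "\<lambda>x. f' (x - u0)"
  let ?g = "\<lambda>x. if desc x0 x then ?f x else ?f' x"
  have S: "Sol ?f" "Sol ?f'"
    using Sol_translate[OF f(1), of "- u0"] Sol_translate[OF f(2), of "- u0"] by simp_all
  have g: "Sol ?g" by (rule glue[OF x0 S(2,1)]) (use s eq in simp)
  define p where "p u = z (\<lambda>x. ?g (x + u))" for u
  define q where "q u = z (\<lambda>x. ?f' (x + u))" for u
  have "p u = q u" if "u \<in> set us" "u \<noteq> u0" for u
    unfolding p_def q_def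
  proof (rule detD[OF W Sol_translate[OF g] Sol_translate[OF S(2)]])
    fix x assume "x \<in> W"
    then show "?g (x + u) = ?f' (x + u)" using inside[OF that] eq by simp
  qed
  then have "sum_list (map p us) = sum_list (map q us) + real (count_list us u0) * (p u0 - q u0)"
    by (rule sum_list_differ_at)
  moreover have "sum_list (map p us) = 0" "sum_list (map q us) = 0"
    unfolding p_def q_def by (rule balancedD[OF bal g], rule balancedD[OF bal S(2)])
  moreover have "count_list us u0 \<noteq> 0" using u0 by (simp add: count_list_0_iff)
  ultimately have "p u0 = q u0" by simp
  moreover have "p u0 = z f"
    unfolding p_def
  proof (rule detD[OF W Sol_translate[OF g] f(1)])
    fix x assume "x \<in> W"
    then show "?g (x + u0) = f x" using out eq by simp
  qed
  moreover have "q u0 = z f'" by (simp add: q_def)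
  ultimately show "z f = z f'" by simp
qed

text \<open>The cut is made at the edge leading to the farthest translate \<open>u0\<close>. The
  other translates lie outside its branch and see there only radius \<open>r\<close> around
  \<open>u0\<close>; from \<open>u0\<close> only radius \<open>r\<close> around its neighbour is
  visible outside. This accounts for the two balls.\<close>

lemma det_shrink_ball:
  assumes bal: "balanced z us" and "us \<noteq> []" and nz: "Sol f" "z f \<noteq> 0" and W: "det z (star_ball (Suc r) 0)"
  obtains c where "det z (star_ball r 0 \<union> star_ball r (fletter (linv c)) \<union> sep0 c)"
proof -
  obtain u0 where u0: "u0 \<in> set us" and max: "\<And>u. u \<in> set us \<Longrightarrow> flen u \<le> flen u0"
    using list_has_maximal[OF assms(2), where L = flen] by blast
  \<comment> \<open>If the farthest translate were the origin, all would be, and the sum would be a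
    nonzero multiple of \<open>z f\<close>.\<close>
  have "u0 \<noteq> 0"
  proof
    assume "u0 = 0"
    have "map (\<lambda>u. z (\<lambda>x. f (x + u))) us = map (\<lambda>u. z f) us"
    proof (rule map_cong[OF HOL.refl])
      fix u assume "u \<in> set us"
      then have "Rep_fg u = []" using max[of u] \<open>u0 = 0\<close> by simp
      then have "u = 0" by (simp add: Rep_fg_inject[symmetric])
      then show "z (\<lambda>x. f (x + u)) = z f" by simp
    qed
    with balancedD[OF bal nz(1)] have "sum_list (map (\<lambda>u. z f) us) = 0" by simp
    then show False using assms(2) nz(2) by (simp add: sum_list_triv)
  qed
  then have "Rep_fg u0 \<noteq> []" by (simp add: Rep_fg_inject[symmetric])
  then obtain c w where w: "Rep_fg u0 = c # w"
    by (cases "Rep_fg u0") auto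
  define y0 where "y0 = lword w"
  have "reduced (c # w)" using reduced_Rep[of u0] w by simp
  then have "Rep_fg y0 = w" by (simp add: y0_def reduced_Cons Rep_lword)
  moreover have "u0 = fletter c + y0"
    using lword_Rep[of u0] w by (simp add: y0_def)
  ultimately have u: "u0 = fletter c + y0" "Rep_fg u0 = c # Rep_fg y0"
    using w by simp_all
  have y: "y0 = fletter (linv c) + u0" using u(1) by simp
  show ?thesis
  proof (rule that[of c], rule det_cut[OF bal u0 W u])
    let ?Q = "star_ball r 0 \<union> star_ball r (fletter (linv c)) \<union> sep0 c"
    have Q: "y - u0 \<in> ?Q \<longleftrightarrow> y \<in> star_ball r u0 \<union> star_ball r y0 \<union> sep c u0" for y
      using y by (simp add: star_ball_translate_iff sep_translate_iff)
    show "y \<in> sep c u0 \<Longrightarrow> y - u0 \<in> ?Q" for y using Q by blast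
    show "x \<in> ?Q" if "x \<in> star_ball (Suc r) 0" "\<not> desc u0 (x + u0)" for x
    proof -
      have "x + u0 \<in> star_ball (Suc r) u0" using star_ball_translate[OF that(1), of u0] by simp
      then have "x + u0 \<in> star_ball r y0 \<union> sep c u0"
        by (rule star_ball_out[OF u suffix_order.refl _ that(2)])
      then show ?thesis using Q[of "x + u0"] by simp
    qed
    show "x + t - u0 \<in> ?Q" if "t \<in> set us" "t \<noteq> u0" "x \<in> star_ball (Suc r) 0" "desc u0 (x + t)" for x t
    proof -
      have "\<not> desc u0 t" using desc_length_eq max that by blast
      moreover have "x + t \<in> star_ball (Suc r) t" using star_ball_translate[OF that(3), of t] by simp
      ultimately have "x + t \<in> star_ball r u0 \<union> sep c u0"
        using star_ball_in[OF u _ _ that(4)] by blast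
      then show ?thesis using Q[of "x + t"] by blast
    qed
  qed
qed

text \<open>The window is centred on an edge. The translated edge reaching farthest is itself the
  place of the cut, and the ball around its near end survives: the near end corresponds to 0 in the
  first case and to \<open>fletter e\<close> in the second.\<close>

lemma det_shrink_edge_ball:
  assumes bal: "balanced z us" and "us \<noteq> []" and "r > 0"
    and W: "det z (star_ball r 0 \<union> star_ball r (fletter e))"
  shows "det z (star_ball r 0) \<or> det z (star_ball r (fletter e))"
proof -
  obtain s where r: "r = Suc s" using \<open>r > 0\<close> by (cases r) auto
  let ?L = "\<lambda>u. max (flen u) (flen (fletter e + u))"
  obtain u0 where u0: "u0 \<in> set us" and max: "\<And>u. u \<in> set us \<Longrightarrow> ?L u \<le> ?L u0"
    using list_has_maximal[OF assms(2), where L = ?L] by blast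
  have tr: "x + t \<in> star_ball r t \<union> star_ball r (fletter e + t)"
    if "x \<in> star_ball r 0 \<union> star_ball r (fletter e)" for x t
    using that star_ball_translate[of x r 0 t] star_ball_translate[of x r "fletter e" t] by auto
  show ?thesis
  proof (cases rule: Rep_fletter_plus_cases[of e u0])
    case 1
    define x0 where "x0 = fletter e + u0"
    have x0: "x0 = fletter e + u0" "Rep_fg x0 = e # Rep_fg u0"
      using 1 by (simp_all add: x0_def)
    have near: "star_ball s x0 \<union> sep e x0 \<subseteq> star_ball r u0" "star_ball s u0 \<union> sep e x0 \<subseteq> star_ball r u0"
      using star_ball_step[of s e u0] star_subset_ball[of r u0] sep_subset_star[OF x0]
        star_ball_mono[of s r u0] by (auto simp: r x0_def)
    have max': "flen t \<le> flen x0 \<and> flen (fletter e + t) \<le> flen x0" if "t \<in> set us" for t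
      using max[OF that] 1 x0_def by simp
    have Q: "y - u0 \<in> star_ball r 0 \<longleftrightarrow> y \<in> star_ball r u0" for y
      by (simp add: star_ball_translate_iff)
    have "det z (star_ball r 0)"
    proof (rule det_cut[OF bal u0 W x0])
      show "y \<in> sep e x0 \<Longrightarrow> y - u0 \<in> star_ball r 0" for y
        using near Q by blast
      show "x \<in> star_ball r 0"
        if x: "x \<in> star_ball r 0 \<union> star_ball r (fletter e)" "\<not> desc x0 (x + u0)" for x
      proof -
        have "x + u0 \<in> star_ball r u0"
          using tr[OF x(1), of u0] star_ball_out[OF x0 suffix_order.refl _ x(2), of s] near(2)
          unfolding r x0_def[symmetric] by blast
        then show ?thesis using Q[of "x + u0"] by simp
      qed
      show "x + t - u0 \<in> star_ball r 0"
        if x: "t \<in> set us" "t \<noteq> u0" "x \<in> star_ball r 0 \<union> star_ball r (fletter e)" "desc x0 (x + t)" for x t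
      proof -
        have "\<not> desc x0 t"
        proof
          assume "desc x0 t"
          then have t: "t = x0" using desc_length_eq max'[OF x(1)] by blast
          \<comment> \<open>A translated edge starting at \<open>x0\<close> would end one step
            beyond the maximum.\<close>
          have "e # Rep_fg x0 = Rep_fg (fletter e + x0)"
            using x0(2) by (cases rule: Rep_fletter_plus_cases[of e x0]) auto
          then show False using max'[OF x(1)] t by (metis length_Cons not_less_eq_eq order_refl)
        qed
        moreover have "\<not> desc x0 (fletter e + t)"
        proof
          assume "desc x0 (fletter e + t)"
          then have "fletter e + t = x0" using desc_length_eq max'[OF x(1)] by blast
          then show False using x(2) by (simp add: x0_def)
        qed
        ultimately have "x + t \<in> star_ball s x0 \<union> sep e x0"
          using tr[OF x(3), of t] star_ball_in[OF x0 _ _ x(4)] unfolding r by blast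
        then show ?thesis using near(1) Q by blast
      qed
    qed
    then show ?thesis ..
  next
    case 2
    define y0 where "y0 = fletter e + u0"
    have x0: "u0 = fletter (linv e) + y0" "Rep_fg u0 = linv e # Rep_fg y0"
      using 2 by (simp_all add: y0_def)
    have near: "star_ball s u0 \<union> sep (linv e) u0 \<subseteq> star_ball r y0" "star_ball s y0 \<union> sep (linv e) u0 \<subseteq> star_ball r y0"
      using star_ball_step[of s "linv e" y0] star_subset_ball[of r y0] sep_subset_star[OF x0]
        star_ball_mono[of s r y0] by (auto simp: r y0_def)
    have max': "flen t \<le> flen u0 \<and> flen (fletter e + t) \<le> flen u0" if "t \<in> set us" for t
      using max[OF that] 2 by simp
    have Q: "y - u0 \<in> star_ball r (fletter e) \<longleftrightarrow> y \<in> star_ball r y0" for y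
      by (simp add: star_ball_translate_iff y0_def)
    have "det z (star_ball r (fletter e))"
    proof (rule det_cut[OF bal u0 W x0])
      show "y \<in> sep (linv e) u0 \<Longrightarrow> y - u0 \<in> star_ball r (fletter e)" for y
        using near Q by blast
      show "x \<in> star_ball r (fletter e)"
        if x: "x \<in> star_ball r 0 \<union> star_ball r (fletter e)" "\<not> desc u0 (x + u0)" for x
      proof -
        have "x + u0 \<in> star_ball r y0"
          using tr[OF x(1), of u0] star_ball_out[OF x0 suffix_order.refl _ x(2), of s] near(2)
          unfolding r y0_def[symmetric] by blast
        then show ?thesis using Q[of "x + u0"] by simp
      qed
      show "x + t - u0 \<in> star_ball r (fletter e)"
        if x: "t \<in> set us" "t \<noteq> u0" "x \<in> star_ball r 0 \<union> star_ball r (fletter e)" "desc u0 (x + t)" for x t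
      proof -
        have "\<not> desc u0 t" using desc_length_eq max'[OF x(1)] x(2) by blast
        moreover have "\<not> desc u0 (fletter e + t)"
        proof
          assume "desc u0 (fletter e + t)"
          then have "fletter e + t = u0" using desc_length_eq max'[OF x(1)] by blast
          then have t: "t = fletter (linv e) + u0" by auto
          have "Rep_fg t = linv e # Rep_fg u0"
            unfolding t using x0(2) by (cases rule: Rep_fletter_plus_cases[of "linv e" u0]) auto
          then show False using max'[OF x(1)] by simp
        qed
        ultimately have "x + t \<in> star_ball s u0 \<union> sep (linv e) u0"
          using tr[OF x(3), of t] star_ball_in[OF x0 _ _ x(4)] unfolding r by blast
        then show ?thesis using near(1) Q by blast
      qed
    qed
    then show ?thesis ..
  qed
qed

lemma balanced_translate:
  assumes "balanced z us"
  shows "balanced (\<lambda>f. z (\<lambda>x. f (x + v))) (map (\<lambda>u. - v + u) us)"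
  using assms by (simp add: balanced_def comp_def add.assoc)

lemma det_translate:
  assumes "det z Q" "\<And>x. x \<in> Q \<Longrightarrow> x + v \<in> Q'"
  shows "det (\<lambda>f. z (\<lambda>x. f (x + v))) Q'"
  unfolding det_def
proof (intro allI impI)
  fix f f' :: "bd fg \<Rightarrow> 'a" assume *: "Sol f" "Sol f'" "\<forall>x\<in>Q'. f x = f' x"
  then show "z (\<lambda>x. f (x + v)) = z (\<lambda>x. f' (x + v))"
    using assms(2) by (intro detD[OF assms(1) Sol_translate[OF *(1)] Sol_translate[OF *(2)]]) blast
qed

text \<open>One round replaces a ball of radius \<open>r + 1\<close> by two neighbouring balls of
  radius \<open>r\<close> and then by one of them, recentred by a translation. From radius 1 the cut
  leaves only the separator, which is a pair of adjacent vertices.\<close>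

lemma det_edge:
  assumes "balanced z us" "us \<noteq> []" "Sol f" "z f \<noteq> 0" "det z (star_ball r 0)"
  shows "\<exists>v g. det (\<lambda>f. z (\<lambda>x. f (x + v))) {0, fgen g}"
  using assms
proof (induction r arbitrary: z us f)
  case 0
  \<comment> \<open>With an empty window \<open>z\<close> is constant on solutions, and any edge
    serves.\<close>
  then have "det (\<lambda>f. z (\<lambda>x. f (x + 0))) {0, fgen LB}"
    by (intro det_translate[OF "0.prems"(5)]) simp
  then show ?case by blast
next
  case (Suc r)
  obtain c where c: "det z (star_ball r 0 \<union> star_ball r (fletter (linv c)) \<union> sep0 c)"
    using det_shrink_ball[OF Suc.prems] .
  show ?case
  proof (cases "r = 0")
    case True
    then have s: "det z (sep0 c)" using c by simp
    have "det (\<lambda>f. z (\<lambda>x. f (x + (if fst c then 0 else - fgen (snd c))))) {0, fgen (snd c)}"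
      by (rule det_translate[OF s]) (auto simp: sep0_def add.assoc split: if_splits)
    then show ?thesis by blast
  next
    case False
    have "sep0 c \<subseteq> star 0"
      using star_gen[where t = "0 :: bd fg"] by (auto simp: sep0_def)
    then have "star_ball r 0 \<union> star_ball r (fletter (linv c)) \<union> sep0 c
       = star_ball r 0 \<union> star_ball r (fletter (linv c))"
      using star_subset_ball[of r 0] False by auto
    with c have "det z (star_ball r 0 \<union> star_ball r (fletter (linv c)))" by simp
    then consider "det z (star_ball r 0)" | "det z (star_ball r (fletter (linv c)))"
      using det_shrink_edge_ball Suc.prems(1,2) False by blast
    then show ?thesis
    proof cases
      case 1
      then show ?thesis using Suc.IH Suc.prems by blast
    next
      case 2
      let ?v = "fletter c"
      let ?z = "\<lambda>f. z (\<lambda>x. f (x + ?v))"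
      have "det ?z (star_ball r 0)"
        by (rule det_translate[OF 2]) (metis star_ball_translate fletter_linv_cancel(3))
      moreover have "balanced ?z (map (\<lambda>u. - ?v + u) us)"
        by (rule balanced_translate[OF Suc.prems(1)])
      moreover have "Sol (\<lambda>x. f (x + - ?v))"
        by (rule Sol_translate[OF Suc.prems(3)])
      ultimately obtain v g where "det (\<lambda>f. ?z (\<lambda>x. f (x + v))) {0, fgen g}"
        using Suc.IH[of ?z "map (\<lambda>u. - ?v + u) us" "\<lambda>x. f (x + - ?v)"] Suc.prems(2,4)
        by (auto simp: add.assoc)
      then have "det (\<lambda>f. z (\<lambda>x. f (x + (?v + v)))) {0, fgen g}"
        by (simp add: add.assoc)
      then show ?thesis by blast
    qed
  qed
qed

section \<open>Functionals supported on an edge\<close>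

lemma Rep_fletter: "Rep_fg (fletter c) = [c]"
  by transfer simp

lemma Ext_near:
  "Ext h (fgen g) = h [(True, g)]" "Ext h 0 = h []" "Ext h (bD + bD) = h [(True, LD), (True, LD)]"
  by (simp_all add: Ext_free Rep_fletter Rep_fletter_plus isbb_iff isdd_iff)

lemma Ext_bb:
  "Ext h (bB + bB) = - h [(True, LD), (True, LD)] + h [(True, LD)] - h [] - h [] + h [(True, LB)]"
proof -
  have "Ext h (bB + (bB + 0)) = - Ext h (bD + (bD + 0)) + Ext h (bD + 0) - Ext h 0 - Ext h 0 + Ext h (bB + 0)"
    by (rule Sol_solve_bb[OF Sol_Ext])
  then show ?thesis by (simp only: add.right_neutral Ext_near)
qed

text \<open>The free vertices on which the values at \<open>sep0 c\<close> depend.\<close>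

definition sep_supp :: "bool \<times> bd \<Rightarrow> (bool \<times> bd) list set" where
  "sep_supp c = (if fst c then {[], [(True, snd c)]}
     else if snd c = LD then {[(True, LD)], [(True, LD), (True, LD)]}
     else {[], [(True, LB)], [(True, LD)], [(True, LD), (True, LD)]})"

lemma Ext_cong_sep0:
  assumes "y \<in> sep0 c" "\<And>v. v \<in> sep_supp c \<Longrightarrow> h v = h' v"
  shows "Ext h y = Ext h' y"
proof -
  obtain s k where c: "c = (s, k)" by (cases c)
  have H: "\<forall>v\<in>sep_supp (s, k). h v = h' v" and y: "y \<in> sep0 (s, k)"
    using assms unfolding c by blast+
  have "(s \<longrightarrow> h [] = h' [] \<and> h [(True, k)] = h' [(True, k)])
    \<and> (\<not> s \<longrightarrow> h [(True, k)] = h' [(True, k)] \<and> h [(True, LD)] = h' [(True, LD)]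
      \<and> h [(True, LD), (True, LD)] = h' [(True, LD), (True, LD)] \<and> (k = LB \<longrightarrow> h [] = h' []))"
    using H by (cases s; cases k) (simp_all add: sep_supp_def)
  then show ?thesis
    using y by (cases s; cases k) (auto simp: sep0_def Ext_near Ext_bb)
qed

text \<open>Beyond \<open>w\<close> a solution can be rebuilt from its free vertices relative to
  \<open>w\<close>, with the one at \<open>e\<close> changed. It still glues to the old solution,
  because \<open>e\<close> has no influence on the separator. The last conclusion tracks the
  dependent vertex \<open>b b w\<close>.\<close>

lemma vary:
  fixes f :: "bd fg \<Rightarrow> 'g::group_add"
  assumes f: "Sol f" and e: "free_vertex e" "reduced (e @ Rep_fg w)"
    and s: "Rep_fg w \<noteq> [] \<Longrightarrow> e \<notin> sep_supp (hd (Rep_fg w))"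
  obtains f' where "Sol f'"
    "\<And>x. (\<And>v. Rep_fg x = v @ Rep_fg w \<Longrightarrow> free_vertex v \<and> v \<noteq> e) \<Longrightarrow> f' x = f x"
    "f' (lword e + w) = a"
    "reduced ((True, LB) # (True, LB) # Rep_fg w) \<Longrightarrow> f' (bB + (bB + w)) =
       Ext ((\<lambda>v. f (lword v + w))(e := a)) (bB + bB)"
proof -
  define h where "h = (\<lambda>v. f (lword v + w))(e := a)"
  let ?F = "\<lambda>x. Ext h (x - w)"
  let ?g = "\<lambda>x. if desc w x then ?F x else f x"
  have F: "Sol ?F" using Sol_translate[OF Sol_Ext, of h "- w"] by simp
  have fw: "f (y + w) = Ext (\<lambda>v. f (lword v + w)) y" for y
    using Sol_eq_Ext[OF Sol_translate[OF f, of w]] by (rule fun_cong)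
  have g: "Sol ?g"
  proof (cases "Rep_fg w")
    case Nil
    then show ?thesis using F by simp
  next
    case (Cons c v)
    define p where "p = lword v"
    have "reduced (c # v)" using Cons reduced_Rep[of w] by simp
    then have "Rep_fg p = v" by (simp add: p_def reduced_Cons Rep_lword)
    moreover have "w = fletter c + p" using lword_Rep[of w] Cons by (simp add: p_def)
    ultimately have w: "w = fletter c + p" "Rep_fg w = c # Rep_fg p" using Cons by simp_all
    show ?thesis
    proof (rule glue[OF w f F])
      fix x assume "x \<in> sep c w"
      then have y: "x - w \<in> sep0 c" by (simp add: sep_translate_iff)
      have "f x = Ext (\<lambda>v. f (lword v + w)) (x - w)" using fw[of "x - w"] by simp
      also have "\<dots> = ?F x"
        by (rule Ext_cong_sep0[OF y]) (use s Cons in \<open>auto simp: h_def\<close>)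
      finally show "f x = ?F x" .
    qed
  qed
  have val: "?g x = ext h v" if "Rep_fg x = v @ Rep_fg w" for x v
  proof -
    have "x = lword v + w" using that by (metis lword_Rep lword_simps(3))
    moreover have "reduced v" using that reduced_Rep[of x] by (simp add: successively_append_iff)
    ultimately show ?thesis using that by (simp add: Ext_def Rep_lword suffix_def)
  qed
  show ?thesis
  proof (rule that[of ?g])
    show "Sol ?g" by (rule g)
    show "?g x = f x" if "\<And>v. Rep_fg x = v @ Rep_fg w \<Longrightarrow> free_vertex v \<and> v \<noteq> e" for x
    proof (cases "desc w x")
      case True
      then obtain v where v: "Rep_fg x = v @ Rep_fg w" by (auto simp: suffix_def)
      then have "lword v + w = x" by (metis lword_Rep lword_simps(3))
      then show ?thesis using val[OF v] that[OF v] by (simp add: ext_free h_def)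
    qed simp
    have "Rep_fg (lword e + w) = e @ Rep_fg w"
      using e(2) by (simp add: Rep_lword_plus foldr_lcons_append)
    then show "?g (lword e + w) = a"
      using val[of "lword e + w" e] e(1) by (simp add: ext_free h_def)
    show "?g (bB + (bB + w)) = Ext ((\<lambda>v. f (lword v + w))(e := a)) (bB + bB)"
      if "reduced ((True, LB) # (True, LB) # Rep_fg w)"
    proof -
      have "Rep_fg (bB + (bB + w)) = [(True, LB), (True, LB)] @ Rep_fg w"
        using that by (simp add: Rep_fletter_plus lcons_eq_Cons reduced_Cons)
      then have "desc w (bB + (bB + w))" by (simp add: suffix_def)
      then show ?thesis by (simp add: h_def add.assoc[symmetric])
    qed
  qed
qed

lemma sum_list_differ_at_two:
  fixes p q :: "'b \<Rightarrow> real"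
  assumes "\<And>u. u \<in> set us \<Longrightarrow> u \<noteq> u0 \<Longrightarrow> u \<noteq> u1 \<Longrightarrow> p u = q u" "u0 \<noteq> u1"
  shows "sum_list (map p us) = sum_list (map q us) + real (count_list us u0) * (p u0 - q u0)
     + real (count_list us u1) * (p u1 - q u1)"
  using assms(1)
proof (induction us)
  case (Cons u us)
  then have "sum_list (map p us) = sum_list (map q us) + real (count_list us u0) * (p u0 - q u0)
     + real (count_list us u1) * (p u1 - q u1)"
    by simp
  then show ?case
    using Cons.prems[of u] assms(2) by (cases "u = u0"; cases "u = u1") (simp_all add: algebra_simps)
qed simp

lemma short_free_vertex: "length v \<le> 2 \<Longrightarrow> v \<noteq> [(True, LB), (True, LB)] \<Longrightarrow> free_vertex v"
  by (auto simp: isbb_iff isdd_iff)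

lemma very_short_free_vertex: "length v \<le> 1 \<Longrightarrow> free_vertex v"
  by (auto simp: isbb_iff isdd_iff)

lemma Rep_eq_append: "Rep_fg x = v @ Rep_fg w \<Longrightarrow> x = lword v + w"
  by (metis lword_Rep lword_simps(3))

lemma Rep_letter_plus: "reduced (c # Rep_fg x) \<Longrightarrow> Rep_fg (fletter c + x) = c # Rep_fg x"
  by (simp add: Rep_fletter_plus lcons_eq_Cons)

lemma Sol_prescribed:
  obtains f :: "bd fg \<Rightarrow> 'g::group_add"
  where "Sol f" "\<And>v. reduced v \<Longrightarrow> free_vertex v \<Longrightarrow> f (lword v + w) = h v"
proof (rule that[of "\<lambda>x. Ext h (x - w)"])
  show "Sol (\<lambda>x. Ext h (x - w))" using Sol_translate[OF Sol_Ext, of h "- w"] by simp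
  show "reduced v \<Longrightarrow> free_vertex v \<Longrightarrow> Ext h (lword v + w - w) = h v" for v
    by (simp add: Ext_free Rep_lword)
qed

section \<open>A function of the two values along a \<open>b\<close>-edge\<close>

context
  fixes Z :: "'g::group_add \<Rightarrow> 'g \<Rightarrow> real" and us :: "bd fg list"
  assumes bal: "\<And>f. Sol f \<Longrightarrow> sum_list (map (\<lambda>u. Z (f u) (f (bB + u))) us) = 0"
begin

lemma edge_differ_one:
  assumes "Sol f" "Sol f'" "u0 \<in> set us"
    and "\<And>u. u \<in> set us \<Longrightarrow> u \<noteq> u0 \<Longrightarrow> f' u = f u \<and> f' (bB + u) = f (bB + u)"
  shows "Z (f u0) (f (bB + u0)) = Z (f' u0) (f' (bB + u0))"
proof -
  have "sum_list (map (\<lambda>u. Z (f' u) (f' (bB + u))) us) = sum_list (map (\<lambda>u. Z (f u) (f (bB + u))) us)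
      + real (count_list us u0) * (Z (f' u0) (f' (bB + u0)) - Z (f u0) (f (bB + u0)))"
    by (rule sum_list_differ_at) (use assms(4) in simp)
  moreover have "count_list us u0 \<noteq> 0" using assms(3) by (simp add: count_list_0_iff)
  ultimately show ?thesis using bal[OF assms(1)] bal[OF assms(2)] by simp
qed

context
  fixes u0 :: "bd fg"
  assumes u0: "u0 \<in> set us"
    and max: "\<And>u. u \<in> set us \<Longrightarrow> max (flen u) (flen (bB + u)) \<le> max (flen u0) (flen (bB + u0))"
begin

text \<open>The far end is \<open>u0\<close>, a free vertex relative to the near end, so its value
  can be changed alone.\<close>

lemma farthest_down:
  assumes r: "Rep_fg u0 = (False, LB) # Rep_fg (bB + u0)"
  shows "Z p q = Z p' q"
proof -
  define y where "y = bB + u0"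
  have u: "u0 = fletter (False, LB) + y" by (simp add: y_def)
  have ry: "reduced ((False, LB) # Rep_fg y)" using r reduced_Rep[of u0] by (simp add: y_def)
  let ?e = "[(False, LB)]"
  obtain f :: "bd fg \<Rightarrow> 'g" where f: "Sol f"
    "\<And>v. reduced v \<Longrightarrow> free_vertex v \<Longrightarrow> f (lword v + y) = ((\<lambda>_. 0)([] := q, ?e := p)) v"
    using Sol_prescribed[of y "(\<lambda>_. 0)([] := q, ?e := p)"] by blast
  have fu: "f u0 = p" "f y = q"
    using f(2)[of ?e] f(2)[of "[]"] by (simp_all add: u isbb_iff isdd_iff)
  obtain f' where f': "Sol f'"
    "\<And>x. (\<And>v. Rep_fg x = v @ Rep_fg y \<Longrightarrow> free_vertex v \<and> v \<noteq> ?e) \<Longrightarrow> f' x = f x"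
    "f' (lword ?e + y) = p'"
    by (rule vary[OF f(1), of ?e y p']) (use ry in \<open>auto simp: isbb_iff isdd_iff sep_supp_def\<close>)
  have same: "f' x = f x" if "flen x \<le> flen u0" "x \<noteq> u0" for x
  proof (rule f'(2))
    fix v assume v: "Rep_fg x = v @ Rep_fg y"
    then have "length v \<le> 1" using that(1) r by (simp add: y_def)
    moreover have "v \<noteq> ?e" using that(2) Rep_eq_append[OF v] u by auto
    ultimately show "free_vertex v \<and> v \<noteq> ?e" using very_short_free_vertex[of v] by auto
  qed
  have "Z (f u0) (f (bB + u0)) = Z (f' u0) (f' (bB + u0))"
  proof (rule edge_differ_one[OF f(1) f'(1) u0])
    fix t assume t: "t \<in> set us" "t \<noteq> u0"
    have len: "flen t \<le> flen u0" "flen (bB + t) \<le> flen u0" using max[OF t(1)] r by auto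
    have "bB + t \<noteq> u0"
    proof
      assume "bB + t = u0"
      then have "t = fletter (False, LB) + u0" by auto
      moreover have "reduced ((False, LB) # Rep_fg u0)"
        using r reduced_Rep[of u0] by (auto simp: reduced_Cons)
      ultimately show False using len(1) by (simp add: Rep_letter_plus)
    qed
    then show "f' t = f t \<and> f' (bB + t) = f (bB + t)" using same len t(2) by blast
  qed
  moreover have "f' u0 = p'" using f'(3) by (simp add: u)
  moreover have "f' y = f y" by (rule same) (use r in \<open>auto simp: y_def\<close>)
  ultimately show ?thesis using fu by (simp add: y_def)
qed

text \<open>The far end \<open>b u0\<close> is free relative to \<open>u0\<close> and has no
  influence on the separator below \<open>u0\<close>, so \<open>q\<close> can be changed
  alone.\<close>

lemma farthest_up_short:
  assumes r: "Rep_fg (bB + u0) = (True, LB) # Rep_fg u0" and h: "take 1 (Rep_fg u0) \<noteq> [(True, LB)]"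
  shows "Z p q = Z p q'"
proof -
  let ?e = "[(True, LB)]"
  have ru: "reduced ((True, LB) # Rep_fg u0)" using r reduced_Rep[of "bB + u0"] by simp
  obtain f :: "bd fg \<Rightarrow> 'g" where f: "Sol f"
    "\<And>v. reduced v \<Longrightarrow> free_vertex v \<Longrightarrow> f (lword v + u0) = ((\<lambda>_. 0)([] := p, ?e := q)) v"
    using Sol_prescribed[of u0 "(\<lambda>_. 0)([] := p, ?e := q)"] by blast
  have fu: "f u0 = p" "f (bB + u0) = q"
    using f(2)[of ?e] f(2)[of "[]"] by (simp_all add: isbb_iff isdd_iff)
  have s: "?e \<notin> sep_supp (hd (Rep_fg u0))" if ne: "Rep_fg u0 \<noteq> []"
  proof -
    obtain s k w where "Rep_fg u0 = (s, k) # w" using ne by (cases "Rep_fg u0") auto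
    then show ?thesis using h ru by (cases k) (auto simp: sep_supp_def)
  qed
  obtain f' where f': "Sol f'"
    "\<And>x. (\<And>v. Rep_fg x = v @ Rep_fg u0 \<Longrightarrow> free_vertex v \<and> v \<noteq> ?e) \<Longrightarrow> f' x = f x"
    "f' (lword ?e + u0) = q'"
    by (rule vary[OF f(1), of ?e u0 q']) (use ru s in \<open>auto simp: isbb_iff isdd_iff\<close>)
  have same: "f' x = f x" if "flen x \<le> Suc (flen u0)" "x \<noteq> bB + u0" for x
  proof (rule f'(2))
    fix v assume v: "Rep_fg x = v @ Rep_fg u0"
    then have "length v \<le> 1" using that(1) by simp
    moreover have "v \<noteq> ?e" using that(2) Rep_eq_append[OF v] by auto
    ultimately show "free_vertex v \<and> v \<noteq> ?e" using very_short_free_vertex[of v] by auto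
  qed
  have "Z (f u0) (f (bB + u0)) = Z (f' u0) (f' (bB + u0))"
  proof (rule edge_differ_one[OF f(1) f'(1) u0])
    fix t assume t: "t \<in> set us" "t \<noteq> u0"
    have len: "flen t \<le> Suc (flen u0)" "flen (bB + t) \<le> Suc (flen u0)" using max[OF t(1)] r by auto
    have "t \<noteq> bB + u0"
    proof
      assume "t = bB + u0"
      moreover have "reduced ((True, LB) # Rep_fg (bB + u0))"
        using r ru by (auto simp: reduced_Cons)
      ultimately show False using len(2) r by (simp add: Rep_letter_plus)
    qed
    then show "f' t = f t \<and> f' (bB + t) = f (bB + t)" using same len t(2) by simp
  qed
  moreover have "f' (bB + u0) = q'" using f'(3) by simp
  moreover have "f' u0 = f u0"
  proof (rule same)
    show "u0 \<noteq> bB + u0" using r by (metis length_Cons n_not_Suc_n)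
  qed simp
  ultimately show ?thesis using fu by simp
qed

context
  fixes w :: "bd fg"
  assumes u: "u0 = bB + w" and r: "reduced ((True, LB) # (True, LB) # Rep_fg w)"
begin

lemma Rep_up: "Rep_fg (bB + w) = (True, LB) # Rep_fg w"
    "Rep_fg (bB + (bB + w)) = (True, LB) # (True, LB) # Rep_fg w"
  using r by (simp_all add: Rep_letter_plus reduced_Cons)

lemma up_long_len: "t \<in> set us \<Longrightarrow> flen t \<le> flen w + 2 \<and> flen (bB + t) \<le> flen w + 2"
  using max[of t] Rep_up by (simp add: u)

lemma up_long_neq: "t \<in> set us \<Longrightarrow> t \<noteq> bB + (bB + w)"
proof
  assume t: "t \<in> set us" "t = bB + (bB + w)"
  have "reduced ((True, LB) # Rep_fg (bB + (bB + w)))"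
    using r by (auto simp: Rep_up)
  then have "flen (bB + t) = flen w + 3" unfolding t(2) by (simp add: Rep_letter_plus Rep_up)
  then show False using up_long_len[OF t(1)] by simp
qed

text \<open>The far end \<open>b b w\<close> is dependent and is steered through the free vertex
  \<open>d d w\<close>. No edge of the list touches \<open>d d w\<close>, since its
  \<open>b\<close>-edges reach length \<open>flen w + 3\<close>.\<close>

lemma farthest_up_long:
  assumes h: "take 1 (Rep_fg w) \<noteq> [(False, LD)]"
  shows "Z p q = Z p q'"
proof -
  let ?e = "[(True, LD), (True, LD)]"
  \<comment> \<open>With value 0 at \<open>w\<close> and \<open>d w\<close>, the relation at
    \<open>w\<close> yields \<open>q\<close> at \<open>b b w\<close> exactly when
    \<open>d d w\<close> carries \<open>p - q\<close>.\<close>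
  obtain f :: "bd fg \<Rightarrow> 'g" where f: "Sol f"
    "\<And>v. reduced v \<Longrightarrow> free_vertex v \<Longrightarrow> f (lword v + w) = ((\<lambda>_. 0)([(True, LB)] := p, ?e := p - q)) v"
    using Sol_prescribed[of w "(\<lambda>_. 0)([(True, LB)] := p, ?e := p - q)"] by blast
  have fw: "f w = 0" "f (bB + w) = p" "f (bD + w) = 0" "f (bD + (bD + w)) = p - q"
    using f(2)[of "[]"] f(2)[of "[(True, LB)]"] f(2)[of "[(True, LD)]"] f(2)[of ?e]
    by (simp_all add: isbb_iff isdd_iff add.assoc)
  have fbb: "f (bB + (bB + w)) = q"
    using Sol_solve_bb[OF f(1), of w] by (simp add: fw)
  have s: "?e \<notin> sep_supp (hd (Rep_fg w))" if ne: "Rep_fg w \<noteq> []"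
  proof -
    obtain s k v where "Rep_fg w = (s, k) # v" using ne by (cases "Rep_fg w") auto
    then show ?thesis using h r by (cases k) (auto simp: sep_supp_def)
  qed
  have re: "reduced (?e @ Rep_fg w)" using h reduced_Rep[of w] by (cases "Rep_fg w") auto
  obtain f' where f': "Sol f'"
    "\<And>x. (\<And>v. Rep_fg x = v @ Rep_fg w \<Longrightarrow> free_vertex v \<and> v \<noteq> ?e) \<Longrightarrow> f' x = f x"
    "f' (bB + (bB + w)) = Ext ((\<lambda>v. f (lword v + w))(?e := p - q')) (bB + bB)"
    by (rule vary[OF f(1), of ?e w "p - q'"]) (use re s r in \<open>auto simp: isbb_iff isdd_iff\<close>)
  have same: "f' x = f x" if "flen x \<le> flen w + 2" "x \<noteq> bB + (bB + w)" "x \<noteq> bD + (bD + w)" for x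
  proof (rule f'(2))
    fix v assume v: "Rep_fg x = v @ Rep_fg w"
    then have "length v \<le> 2" using that(1) by simp
    moreover have "v \<noteq> ?e" "v \<noteq> [(True, LB), (True, LB)]"
      using that(2,3) Rep_eq_append[OF v] by (auto simp: add.assoc)
    ultimately show "free_vertex v \<and> v \<noteq> ?e" using short_free_vertex[of v] by auto
  qed
  have dd: "Rep_fg (bD + (bD + w)) = ?e @ Rep_fg w"
    using re by (simp add: Rep_letter_plus reduced_Cons)
  have long: "flen (fletter (s, LB) + (bD + (bD + w))) = flen w + 3" for s
    using re by (subst Rep_letter_plus) (simp_all add: dd reduced_Cons)
  have "Z (f u0) (f (bB + u0)) = Z (f' u0) (f' (bB + u0))"
  proof (rule edge_differ_one[OF f(1) f'(1) u0])
    fix t assume t: "t \<in> set us" "t \<noteq> u0"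
    note len = up_long_len[OF t(1)]
    have "t \<noteq> bD + (bD + w)" using long[of True] len by auto
    moreover have "bB + t \<noteq> bD + (bD + w)"
    proof
      assume "bB + t = bD + (bD + w)"
      then have "t = fletter (False, LB) + (bD + (bD + w))" by (metis fletter_cancel(1))
      then show False using long[of False] len by simp
    qed
    ultimately show "f' t = f t \<and> f' (bB + t) = f (bB + t)"
      using same len up_long_neq[OF t(1)] t(2) by (simp add: u)
  qed
  moreover have "f' (bB + (bB + w)) = q'"
    unfolding f'(3) Ext_bb using fw by simp
  moreover have "f' (bB + w) = p"
  proof -
    have "bB + w \<noteq> bB + (bB + w)" using Rep_up by (metis length_Cons n_not_Suc_n)
    moreover have "bB + w \<noteq> bD + (bD + w)" using Rep_up dd by (metis append_Cons list.inject prod.inject bd.distinct(1))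
    ultimately show ?thesis using same[of "bB + w"] fw Rep_up by simp
  qed
  ultimately show ?thesis using fw fbb by (simp add: u)
qed

text \<open>As \<open>w\<close> begins with \<open>d\<inverse>\<close>, the vertex
  \<open>d d w\<close> lies outside the branch beyond \<open>w\<close> and cannot be changed alone.
  Changing \<open>f (b w)\<close> instead moves \<open>f (b b w) = k + f (b w)\<close> along, where
  \<open>k\<close> collects the other terms of the relation. Two summands change, giving a
  functional equation.\<close>

lemma farthest_up_tied:
  assumes h: "take 1 (Rep_fg w) = [(False, LD)]"
  shows "real (count_list us w) * (Z p q' - Z p q)
    + real (count_list us u0) * (Z q' (k + q') - Z q (k + q)) = 0"
proof -
  let ?e = "[(True, LB)]" and ?d = "[(True, LD), (True, LD)]"
  obtain f :: "bd fg \<Rightarrow> 'g" where f: "Sol f"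
    "\<And>v. reduced v \<Longrightarrow> free_vertex v \<Longrightarrow> f (lword v + w) = ((\<lambda>_. 0)([] := p, ?e := q, ?d := - (k + p + p))) v"
    using Sol_prescribed[of w "(\<lambda>_. 0)([] := p, ?e := q, ?d := - (k + p + p))"] by blast
  have fw: "f w = p" "f (bB + w) = q" "f (bD + w) = 0" "f (bD + (bD + w)) = - (k + p + p)"
    using f(2)[of "[]"] f(2)[of ?e] f(2)[of "[(True, LD)]"] f(2)[of ?d]
    by (simp_all add: isbb_iff isdd_iff add.assoc del: minus_add)
  have fbb: "f (bB + (bB + w)) = k + q"
    using Sol_solve_bb[OF f(1), of w] by (simp only: fw minus_minus add.right_neutral add_diff_cancel)
  have s: "?e \<notin> sep_supp (hd (Rep_fg w))"
    using h by (cases "Rep_fg w") (auto simp: sep_supp_def)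
  obtain f' where f': "Sol f'"
    "\<And>x. (\<And>v. Rep_fg x = v @ Rep_fg w \<Longrightarrow> free_vertex v \<and> v \<noteq> ?e) \<Longrightarrow> f' x = f x"
    "f' (lword ?e + w) = q'"
    "f' (bB + (bB + w)) = Ext ((\<lambda>v. f (lword v + w))(?e := q')) (bB + bB)"
    by (rule vary[OF f(1), of ?e w q']) (use s r in \<open>auto simp: isbb_iff isdd_iff\<close>)
  have same: "f' x = f x" if "flen x \<le> flen w + 2" "x \<noteq> bB + (bB + w)" "x \<noteq> bB + w" for x
  proof (rule f'(2))
    fix v assume v: "Rep_fg x = v @ Rep_fg w"
    then have "length v \<le> 2" using that(1) by simp
    moreover have "v \<noteq> ?e" "v \<noteq> [(True, LB), (True, LB)]"
      using that(2,3) Rep_eq_append[OF v] by (auto simp: add.assoc)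
    ultimately show "free_vertex v \<and> v \<noteq> ?e" using short_free_vertex[of v] by auto
  qed
  have w: "w \<noteq> bB + w" "w \<noteq> bB + (bB + w)" "bB + w \<noteq> bB + (bB + w)"
    using Rep_up by (metis length_Cons n_not_Suc_n less_irrefl_nat lessI less_SucI)+
  have "sum_list (map (\<lambda>u. Z (f' u) (f' (bB + u))) us) = sum_list (map (\<lambda>u. Z (f u) (f (bB + u))) us)
      + real (count_list us w) * (Z (f' w) (f' (bB + w)) - Z (f w) (f (bB + w)))
      + real (count_list us u0) * (Z (f' u0) (f' (bB + u0)) - Z (f u0) (f (bB + u0)))"
  proof (rule sum_list_differ_at_two)
    show "w \<noteq> u0" using w by (simp add: u)
    fix t assume t: "t \<in> set us" "t \<noteq> w" "t \<noteq> u0"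
    have "f' t = f t" "f' (bB + t) = f (bB + t)"
      using same up_long_len[OF t(1)] up_long_neq[OF t(1)] t(2,3) by (simp_all add: u)
    then show "Z (f' t) (f' (bB + t)) = Z (f t) (f (bB + t))" by simp
  qed
  moreover have "f' w = p" using same[of w] w fw by simp
  moreover have "f' (bB + w) = q'" using f'(3) by simp
  moreover have "f' (bB + (bB + w)) = k + q'"
    unfolding f'(4) Ext_bb using fw
    by (simp add: add.assoc del: minus_add) (simp only: minus_minus add.assoc[symmetric] add_diff_cancel)
  ultimately show ?thesis
    using bal[OF f(1)] bal[OF f'(1)] fw fbb by (simp add: u)
qed

end

end

text \<open>Either one variable is irrelevant, or only the difference \<open>q - p\<close> matters,
  or the variables separate. In every case \<open>Z\<close> is recovered from its values with one
  argument 0.\<close>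

lemma edge_function_cases:
  assumes "us \<noteq> []"
  shows "(\<forall>p q. Z p q = Z 0 q) \<or> (\<forall>p q. Z p q = Z p 0) \<or> (\<forall>q k. Z q (k + q) = Z 0 k)
    \<or> (\<forall>p q. Z p q = Z p 0 + Z 0 q - Z 0 0)"
proof -
  let ?L = "\<lambda>u. max (flen u) (flen (bB + u))"
  obtain u0 where u0: "u0 \<in> set us" and max: "\<And>u. u \<in> set us \<Longrightarrow> ?L u \<le> ?L u0"
    using list_has_maximal[OF assms, where L = ?L] by blast
  show ?thesis
  proof (cases rule: Rep_fletter_plus_cases[of "(True, LB)" u0])
    case 2
    then have "\<forall>p q. Z p q = Z 0 q" using farthest_down[OF u0 max] by simp
    then show ?thesis by blast
  next
    case 1
    show ?thesis
    proof (cases "take 1 (Rep_fg u0) = [(True, LB)]")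
      case False
      then have "\<forall>p q. Z p q = Z p 0" using farthest_up_short[OF u0 max 1] by blast
      then show ?thesis by blast
    next
      case True
      then obtain v where v: "Rep_fg u0 = (True, LB) # v" by (cases "Rep_fg u0") auto
      define w where "w = lword v"
      have "reduced ((True, LB) # v)" using reduced_Rep[of u0] v by simp
      then have w: "Rep_fg w = v" by (simp add: w_def reduced_Cons Rep_lword)
      have u: "u0 = bB + w" using lword_Rep[of u0] v by (simp add: w_def)
      have r: "reduced ((True, LB) # (True, LB) # Rep_fg w)"
        using reduced_Rep[of "bB + u0"] 1 v w by simp
      show ?thesis
      proof (cases "take 1 (Rep_fg w) = [(False, LD)]")
        case False
        then have "\<forall>p q. Z p q = Z p 0" using farthest_up_long[OF u0 max u r] by blast
        then show ?thesis by blast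
      next
        case True
        define m where "m = real (count_list us w)"
        define n where "n = real (count_list us u0)"
        have n: "n \<noteq> 0" using u0 by (simp add: n_def count_list_0_iff)
        have e: "m * (Z p q' - Z p q) + n * (Z q' (k + q') - Z q (k + q)) = 0" for p q q' k
          unfolding m_def n_def by (rule farthest_up_tied[OF u0 max u r True])
        show ?thesis
        proof (cases "m = 0")
          case True
          then have "Z q (k + q) = Z 0 k" for q k
            using e[of 0 q 0 k] n by simp
          then show ?thesis by blast
        next
          case False
          have "Z p q = Z p 0 + Z 0 q - Z 0 0" for p q
          proof -
            \<comment> \<open>The second summand of \<open>e\<close> does not involve
              \<open>p\<close>, so comparing \<open>p\<close> with 0 eliminates it.\<close>
            have "m * (Z p q - Z p 0) = m * (Z 0 q - Z 0 0)"
              using e[of p q 0 0] e[of 0 q 0 0] by linarith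
            then show ?thesis using False by simp
          qed
          then show ?thesis by blast
        qed
      qed
    qed
  qed
qed

end

section \<open>Real solutions with prescribed inequalities\<close>

lemma ext_cong: "(\<And>y. weight y \<le> weight x \<Longrightarrow> h y = h' y) \<Longrightarrow> ext h x = ext h' x"
proof (induction "weight x" arbitrary: x rule: less_induct)
  case less
  have IH: "ext h y = ext h' y" if "weight y < weight x" for y
    using that less.prems by (intro less.hyps) auto
  consider "isbb x" | "isdd x" | "free_vertex x" by blast
  then show ?case
  proof cases
    case 1
    then obtain w where x: "x = (True, LB) # (True, LB) # w" by (auto simp: isbb_iff)
    have "ext h y = ext h' y"
      if "y \<in> {lcons (True, LD) (lcons (True, LD) w), lcons (True, LD) w, w, (True, LB) # w}" for y
      using that x by (intro IH) (auto simp: weight_dd_less weight_lcons_less weight_less)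
    then show ?thesis
      unfolding ext.simps[of h x] ext.simps[of h' x] using 1 x by simp
  next
    case 2
    then obtain w where x: "x = (True, LD) # (True, LD) # (False, LB) # w" by (auto simp: isdd_iff)
    then have nb: "\<not> isbb x" by (simp add: isbb_iff)
    have "ext h y = ext h' y"
      if "y \<in> {(True, LD) # (False, LB) # w, (False, LB) # w, lcons (True, LB) w, w}" for y
      using that x by (intro IH) (auto simp: weight_lcons_less weight_less)
    then show ?thesis
      unfolding ext.simps[of h x] ext.simps[of h' x] using 2 nb x by simp
  next
    case 3
    then show ?thesis using less.prems by (simp add: ext_free)
  qed
qed

text \<open>The value at a free vertex may depend on the solution under construction at all vertices
  of smaller weight, dependent ones included.\<close>

lemma Sol_recursive:
  fixes H :: "((bool \<times> bd) list \<Rightarrow> 'g::group_add) \<Rightarrow> (bool \<times> bd) list \<Rightarrow> 'g"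
  assumes H: "\<And>f g x. (\<And>y. weight y < weight x \<Longrightarrow> f y = g y) \<Longrightarrow> H f x = H g x"
  obtains e where "Sol (\<lambda>v. e (Rep_fg v))" "\<And>x. free_vertex x \<Longrightarrow> e x = H e x"
proof -
  define h where "h = wfrec (measure weight) (\<lambda>h x. H (ext h) x)"
  have h: "h x = H (ext h) x" for x
  proof -
    have "h x = H (ext (cut h (measure weight) x)) x"
      unfolding h_def by (subst wfrec) simp_all
    also have "\<dots> = H (ext h) x"
      by (intro H ext_cong) (simp add: cut_apply)
    finally show ?thesis .
  qed
  show ?thesis
    using Sol_Ext[of h] h by (intro that[of "ext h"]) (simp_all add: Ext_def[abs_def] ext_free)
qed

lemma Rep_cases_b:
  obtains y where "Rep_fg u = (False, LB) # Rep_fg y" "y = bB + u"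
  | "Rep_fg (bB + u) = (True, LB) # Rep_fg u"
  using Rep_fletter_plus_cases[of "(True, LB)" u] by auto

lemma reduced_Rep_tl: "Rep_fg u = c # w \<Longrightarrow> Rep_fg (lword w) = w \<and> u = fletter c + lword w"
  using reduced_Rep[of u] lword_Rep[of u] by (auto simp: Rep_lword reduced_Cons)

text \<open>The aim at a free end is \<open>f (b u) = \<rho> * f u + 1\<close>. If
  \<open>b u = b b w\<close> is dependent, the choice at \<open>d d w\<close> corrects it. When
  \<open>w\<close> begins with \<open>d\<inverse>\<close> that vertex comes too early; then
  \<open>f (b w)\<close> is 0 and \<open>f w\<close> is so negative that the relation forces
  \<open>f (b b w) > 0\<close>.\<close>

lemma exists_growing_solution:
  assumes "\<rho> > 0"
  obtains f :: "bd fg \<Rightarrow> real" where "Sol f" "\<And>u. f (bB + u) > \<rho> * f u"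
proof -
  \<comment> \<open>For \<open>x = d\<inverse> y\<close> the two absolute values are those at
    \<open>d d x\<close> and \<open>d x\<close>. The clause for \<open>d d w\<close> is the relation
    solved for it under \<open>f (b b w) = \<rho> * f (b w) + 1\<close>.\<close>
  define H :: "((bool \<times> bd) list \<Rightarrow> real) \<Rightarrow> (bool \<times> bd) list \<Rightarrow> real" where
    "H f x = (case x of [] \<Rightarrow> 0
      | c # y \<Rightarrow>
        if c = (False, LB) then (f y - 1) / \<rho>
        else if c = (False, LD) then - (1 + \<bar>f (lcons (True, LD) y)\<bar> + \<bar>f y\<bar>)
        else if c = (True, LB) then (if take 1 y = [(False, LD)] then 0 else \<rho> * f y + 1)
        else if take 1 y = [(True, LD)] then
          f y - 2 * f (tl y) + f ((True, LB) # tl y) - \<rho> * f ((True, LB) # tl y) - 1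
        else 0)" for f x
  have H_cong: "H f x = H g x" if *: "\<And>y. weight y < weight x \<Longrightarrow> f y = g y" for f g x
  proof (cases x)
    case Nil
    then show ?thesis by (simp add: H_def)
  next
    case (Cons c y)
    have y: "f y = g y" using Cons by (intro *) (simp add: weight_less)
    have 1: "f (lcons (True, LD) y) = g (lcons (True, LD) y)" if "c = (False, LD)"
    proof (rule *)
      show "weight (lcons (True, LD) y) < weight x"
        using Cons that by (cases y) (auto simp: weight_def)
    qed
    have 2: "f (tl y) = g (tl y)" "f ((True, LB) # tl y) = g ((True, LB) # tl y)" if "take 1 y = [(True, LD)]"
      using Cons that by (cases y; intro *; simp add: weight_def)+
    show ?thesis unfolding H_def Cons using y 1 2 by auto
  qed
  obtain e where e: "Sol (\<lambda>v. e (Rep_fg v))" "\<And>x. free_vertex x \<Longrightarrow> e x = H e x"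
    using Sol_recursive[of H, OF H_cong] by blast
  define f where "f v = e (Rep_fg v)" for v
  have f: "Sol f" using e(1) by (simp add: f_def[abs_def])
  have "f (bB + u) > \<rho> * f u" for u
  proof (cases rule: Rep_cases_b[of u])
    case (1 y)
    then have "f u = (f (bB + u) - 1) / \<rho>"
      using e(2)[of "Rep_fg u"] by (simp add: f_def H_def isbb_iff isdd_iff)
    then show ?thesis using assms by simp
  next
    case 2
    show ?thesis
    proof (cases "isbb (Rep_fg (bB + u))")
      case False
      then have "f (bB + u) = (if take 1 (Rep_fg u) = [(False, LD)] then 0 else \<rho> * f u + 1)"
        using e(2)[of "Rep_fg (bB + u)"] 2 by (simp add: f_def H_def isdd_iff)
      moreover have "f u < 0" if ld: "take 1 (Rep_fg u) = [(False, LD)]"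
      proof -
        obtain v where "Rep_fg u = (False, LD) # v" using ld by (cases "Rep_fg u") auto
        then show ?thesis
          using e(2)[of "Rep_fg u"] by (simp add: f_def H_def isbb_iff isdd_iff)
      qed
      ultimately show ?thesis using assms by (auto simp: mult_pos_neg)
    next
      case True
      then obtain v where v: "Rep_fg u = (True, LB) # v" using 2 by (auto simp: isbb_iff)
      define w where "w = lword v"
      have w: "Rep_fg w = v" "u = bB + w"
        using reduced_Rep_tl[OF v] by (simp_all add: w_def)
      have red: "reduced ((True, LB) # (True, LB) # Rep_fg w)"
        using 2 v w(1) by (metis reduced_Rep)
      have solve: "f (bB + u) = - f (bD + (bD + w)) + f (bD + w) - f w - f w + f u"
        unfolding w(2) by (rule Sol_solve_bb[OF f])
      show ?thesis
      proof (cases "take 1 (Rep_fg w) = [(False, LD)]")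
        case True
        then obtain t where t: "Rep_fg w = (False, LD) # t" by (cases "Rep_fg w") auto
        have "f w = - (1 + \<bar>f (bD + (bD + w))\<bar> + \<bar>f (bD + w)\<bar>)"
          using e(2)[of "Rep_fg w"] t by (simp add: f_def H_def isbb_iff isdd_iff Rep_fletter_plus)
        moreover have "Rep_fg u = (True, LB) # (False, LD) # t" using v w(1) t by simp
        then have "f u = 0"
          using e(2)[of "Rep_fg u"] by (simp add: f_def H_def isbb_iff isdd_iff)
        ultimately show ?thesis using solve by simp
      next
        case False
        have dd: "Rep_fg (bD + (bD + w)) = (True, LD) # (True, LD) # Rep_fg w" "Rep_fg (bD + w) = (True, LD) # Rep_fg w"
          using False by (cases "Rep_fg w"; simp add: Rep_fletter_plus)+
        have "free_vertex (Rep_fg (bD + (bD + w)))"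
          using red by (auto simp: dd isbb_iff isdd_iff)
        then have "f (bD + (bD + w)) = f (bD + w) - 2 * f w + f u - \<rho> * f u - 1"
          using e(2)[of "Rep_fg (bD + (bD + w))"] v w by (simp add: f_def H_def dd)
        then show ?thesis using solve by simp
      qed
    qed
  qed
  then show ?thesis using that f by blast
qed

text \<open>In the relation solved for a dependent vertex, the subtracted terms are outweighed by a
  positive one chosen large in advance: the summand \<open>2 * f y + 2\<close> absorbs the two
  copies of the centre, and the remaining subtracted term is either set to 1 or covered by an
  absolute value.\<close>

lemma exists_positive_solution:
  obtains f :: "bd fg \<Rightarrow> real" where "Sol f" "\<And>u. f u > 0"
proof -
  define H :: "((bool \<times> bd) list \<Rightarrow> real) \<Rightarrow> (bool \<times> bd) list \<Rightarrow> real" where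
    "H f x = (case x of [] \<Rightarrow> 1
      | c # y \<Rightarrow>
        if \<not> fst c then 1
        else if c = (True, LB) then
          2 * f y + 2 + (if take 1 y = [(False, LD)] then \<bar>f (lcons (True, LD) (tl y))\<bar> else 0)
        else if take 1 y = [(True, LD)] then 1
        else 2 * f y + 2 + (if take 1 y = [(False, LB)] then \<bar>f (lcons (True, LB) (tl y))\<bar> else 0))" for f x
  have H_cong: "H f x = H g x" if *: "\<And>y. weight y < weight x \<Longrightarrow> f y = g y" for f g x
  proof (cases x)
    case Nil
    then show ?thesis by (simp add: H_def)
  next
    case (Cons c y)
    have y: "f y = g y" using Cons by (intro *) (simp add: weight_less)
    have 1: "f (lcons k (tl y)) = g (lcons k (tl y))" if "y \<noteq> []" for k
      using Cons that by (intro *) (auto intro!: weight_lcons_less)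
    show ?thesis unfolding H_def Cons using y 1 by (cases "y = []") auto
  qed
  obtain e where e: "Sol (\<lambda>v. e (Rep_fg v))" "\<And>x. free_vertex x \<Longrightarrow> e x = H e x"
    using Sol_recursive[of H, OF H_cong] by blast
  define f where "f v = e (Rep_fg v)" for v
  have f: "Sol f" using e(1) by (simp add: f_def[abs_def])
  have fb: "f (bB + w) = 2 * f w + 2 + (if take 1 (Rep_fg w) = [(False, LD)] then \<bar>f (bD + (bD + w))\<bar> else 0)"
    if "Rep_fg (bB + w) = (True, LB) # Rep_fg w" "take 1 (Rep_fg w) \<noteq> [(True, LB)]" for w
    using that e(2)[of "Rep_fg (bB + w)"]
    by (cases "Rep_fg w") (auto simp: f_def H_def isbb_iff isdd_iff Rep_fletter_plus)
  have fd: "f (bD + w) = 2 * f w + 2 + (if take 1 (Rep_fg w) = [(False, LB)] then \<bar>f (bB + (bB + w))\<bar> else 0)"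
    if "Rep_fg (bD + w) = (True, LD) # Rep_fg w" "take 1 (Rep_fg w) \<noteq> [(True, LD)]" for w
    using that e(2)[of "Rep_fg (bD + w)"]
    by (cases "Rep_fg w") (auto simp: f_def H_def isbb_iff isdd_iff Rep_fletter_plus)
  have "f u > 0" for u
  proof (induction "weight (Rep_fg u)" arbitrary: u rule: less_induct)
    case less
    consider "Rep_fg u = []" | k w where "Rep_fg u = (False, k) # w"
      | w where "Rep_fg u = (True, LB) # w" | w where "Rep_fg u = (True, LD) # w"
      by (metis (full_types) bd.exhaust list.exhaust surj_pair)
    then show ?case
    proof cases
      case 1
      then show ?thesis using e(2)[of "Rep_fg u"] by (simp add: f_def H_def isbb_iff isdd_iff)
    next
      case (2 k w)
      then show ?thesis using e(2)[of "Rep_fg u"] by (simp add: f_def H_def isbb_iff isdd_iff)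
    next
      case (3 w)
      define y where "y = lword w"
      have y: "Rep_fg y = w" "u = bB + y" "Rep_fg u = (True, LB) # Rep_fg y"
        using reduced_Rep_tl[OF 3] 3 by (simp_all add: y_def)
      have ypos: "f y > 0" using y(3) by (intro less) (simp add: weight_less)
      show ?thesis
      proof (cases "take 1 (Rep_fg y) = [(True, LB)]")
        case False
        then show ?thesis using fb[of y] y ypos by (simp add: add_pos_nonneg)
      next
        case True
        then obtain v where v: "Rep_fg y = (True, LB) # v" by (cases "Rep_fg y") auto
        define t where "t = lword v"
        have t: "Rep_fg t = v" "y = bB + t" "Rep_fg y = (True, LB) # Rep_fg t"
          using reduced_Rep_tl[OF v] v by (simp_all add: t_def)
        have tpos: "f t > 0" using y(3) t(3) by (intro less) (simp add: weight_less)
        have red: "reduced ((True, LB) # (True, LB) # Rep_fg t)"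
          using y(3) t(3) by (metis reduced_Rep)
        have solve: "f u = - f (bD + (bD + t)) + f (bD + t) - f t - f t + f y"
          unfolding y(2) t(2) by (rule Sol_solve_bb[OF f])
        have dpos: "f (bD + t) > 0"
          using y(3) t(3) by (intro less) (simp add: Rep_fletter_plus weight_lcons_less)
        show ?thesis
        proof (cases "take 1 (Rep_fg t) = [(False, LD)]")
          case True
          then have "take 1 (Rep_fg t) \<noteq> [(True, LB)]" by simp
          then have "f y = 2 * f t + 2 + \<bar>f (bD + (bD + t))\<bar>"
            using fb[of t] t True by simp
          then show ?thesis using solve dpos by simp
        next
          case False
          have dd: "Rep_fg (bD + (bD + t)) = (True, LD) # (True, LD) # Rep_fg t" "Rep_fg (bD + t) = (True, LD) # Rep_fg t"
            using False by (cases "Rep_fg t"; simp add: Rep_fletter_plus)+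
          have "free_vertex (Rep_fg (bD + (bD + t)))"
            using red by (auto simp: dd isbb_iff isdd_iff)
          then have 1: "f (bD + (bD + t)) = 1"
            using e(2)[of "Rep_fg (bD + (bD + t))"] by (simp add: f_def H_def dd)
          show ?thesis
          proof (cases "take 1 (Rep_fg t) = [(True, LB)]")
            case True
            then have "take 1 (Rep_fg t) \<noteq> [(True, LD)]" "take 1 (Rep_fg t) \<noteq> [(False, LB)]" by auto
            then have "f (bD + t) = 2 * f t + 2" using fd[of t] dd(2) by simp
            then show ?thesis using solve 1 ypos by simp
          next
            case F: False
            then have "f y = 2 * f t + 2" using fb[of t] t False by simp
            then show ?thesis using solve 1 dpos by simp
          qed
        qed
      qed
    next
      case (4 w)
      define y where "y = lword w"
      have y: "Rep_fg y = w" "u = bD + y" "Rep_fg u = (True, LD) # Rep_fg y"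
        using reduced_Rep_tl[OF 4] 4 by (simp_all add: y_def)
      have ypos: "f y > 0" using y(3) by (intro less) (simp add: weight_less)
      show ?thesis
      proof (cases "take 1 (Rep_fg y) = [(True, LD)]")
        case False
        then show ?thesis using fd[of y] y ypos by (simp add: add_pos_nonneg)
      next
        case True
        then obtain v where v: "Rep_fg y = (True, LD) # v" by (cases "Rep_fg y") auto
        define t where "t = lword v"
        have t: "Rep_fg t = v" "y = bD + t" "Rep_fg y = (True, LD) # Rep_fg t"
          using reduced_Rep_tl[OF v] v by (simp_all add: t_def)
        show ?thesis
        proof (cases "isdd (Rep_fg u)")
          case False
          then show ?thesis
            using e(2)[of "Rep_fg u"] y(3) t(3) by (simp add: f_def H_def isbb_iff)
        next
          case True
          then have lb: "take 1 (Rep_fg t) = [(False, LB)]" using y(3) t(3) by (auto simp: isdd_iff)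
          then obtain x where x: "Rep_fg t = (False, LB) # x" by (cases "Rep_fg t") auto
          have "f y = 2 * f t + 2 + \<bar>f (bB + (bB + t))\<bar>"
            using fd[of t] t lb by simp
          moreover have "f (bB + t) > 0"
            using y(3) t(3) x by (intro less) (simp add: Rep_fletter_plus weight_less)
          moreover have "f u = f y - f t - (f (bB + (bB + t)) - f (bB + t) + f t)"
            unfolding y(2) t(2) by (rule Sol_solve_dd[OF f])
          ultimately show ?thesis by simp
        qed
      qed
    qed
  qed
  then show ?thesis using that f by blast
qed

section \<open>Torsion-freeness and orderability\<close>

lemma sum_list_pos:
  fixes g :: "'b \<Rightarrow> real"
  assumes "us \<noteq> []" "\<And>u. g u > 0"
  shows "sum_list (map g us) > 0"
  using assms(1)
proof (induction us)
  case (Cons u us)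
  then show ?case using assms(2)[of u] by (cases "us = []") (auto intro: add_pos_pos)
qed simp

text \<open>Coefficients of equal sign are refuted by a positive solution, those of opposite sign by
  a solution growing at rate \<open>- m / n\<close> along \<open>b\<close>-edges: either way all
  summands have the same strict sign.\<close>

lemma real_edge_function_zero:
  fixes m n :: real
  assumes bal: "\<And>f :: bd fg \<Rightarrow> real. Sol f \<Longrightarrow> sum_list (map (\<lambda>u. m * f u + n * f (bB + u)) us) = 0"
    and us: "us \<noteq> []"
  shows "m = 0 \<and> n = 0"
proof (rule ccontr)
  assume nz: "\<not> (m = 0 \<and> n = 0)"
  have contra: False if "Sol f" "\<And>u. s * (m * f u + n * f (bB + u)) > 0" for f s
  proof -
    have "s * sum_list (map (\<lambda>u. m * f u + n * f (bB + u)) us) > 0"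
      using sum_list_pos[OF us that(2)] by (simp add: sum_list_const_mult)
    then show False using bal[OF that(1)] by simp
  qed
  have comb: "m * x + n * y > 0" if "m \<ge> 0" "n \<ge> 0" "\<not> (m = 0 \<and> n = 0)" "x > 0" "y > 0"
    for m n x y :: real
  proof (cases "m = 0")
    case False
    then show ?thesis using that by (intro add_pos_nonneg) auto
  qed (use that in auto)
  obtain f :: "bd fg \<Rightarrow> real" where f: "Sol f" "\<And>u. f u > 0"
    by (rule exists_positive_solution) blast
  consider "m \<ge> 0" "n \<ge> 0" | "m \<le> 0" "n \<le> 0" | "m * n < 0"
    by (metis linear mult_neg_pos mult_pos_neg not_less order_le_less)
  then show False
  proof cases
    case 1
    have "1 * (m * f u + n * f (bB + u)) > 0" for u
      using comb[OF 1 nz f(2) f(2)] by simp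
    then show False by (rule contra[OF f(1)])
  next
    case 2
    have "- 1 * (m * f u + n * f (bB + u)) > 0" for u
      using comb[of "- m" "- n" "f u" "f (bB + u)"] 2 nz f(2) by simp
    then show False by (rule contra[OF f(1)])
  next
    case 3
    then have n: "n \<noteq> 0" and \<rho>: "- m / n > 0"
      by (auto simp: mult_less_0_iff divide_less_0_iff)
    obtain g :: "bd fg \<Rightarrow> real" where g: "Sol g" "\<And>u. g (bB + u) > - m / n * g u"
      using exists_growing_solution[OF \<rho>] by blast
    have "n * (m * g u + n * g (bB + u)) > 0" for u
    proof -
      have "n * (m * g u + n * g (bB + u)) = n\<^sup>2 * (g (bB + u) - - m / n * g u)"
        using n by (simp add: field_simps power2_eq_square)
      then show ?thesis using g(2)[of u] n by simp
    qed
    then show False by (rule contra[OF g(1)])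
  qed
qed

lemma Sol_linear_combination:
  fixes f g :: "bd fg \<Rightarrow> real"
  assumes "Sol f" "Sol g"
  shows "Sol (\<lambda>x. c * f x + k * g x)"
  unfolding Sol_def
proof
  fix w
  have "f (bB + (bB + w)) = - f (bD + (bD + w)) + f (bD + w) - f w - f w + f (bB + w)"
    "g (bB + (bB + w)) = - g (bD + (bD + w)) + g (bD + w) - g w - g w + g (bB + w)"
    using Sol_solve_bb assms by blast+
  then show "c * f (bB + (bB + w)) + k * g (bB + (bB + w)) - (c * f (bB + w) + k * g (bB + w)) + (c * f w + k * g w)
    = - (c * f (bD + (bD + w)) + k * g (bD + (bD + w))) + (c * f (bD + w) + k * g (bD + w)) - (c * f w + k * g w)"
    by (simp only:) (simp add: algebra_simps)
qed

lemma real_functional_zero: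
  fixes z :: "(bd fg \<Rightarrow> real) \<Rightarrow> real"
  assumes "det z {0, bB}" "balanced z us" "us \<noteq> []"
    and add: "\<And>f g. z (\<lambda>x. f x + g x) = z f + z g"
    and scale: "\<And>c f. z (\<lambda>x. c * f x) = c * z f"
    and f: "Sol f"
  shows "z f = 0"
proof -
  define e where "e v = (\<lambda>x. if x = v then 1 else 0 :: real)" for v :: "(bool \<times> bd) list"
  define m where "m = z (Ext (e []))"
  define n where "n = z (Ext (e [(True, LB)]))"
  have lin: "z f = m * f 0 + n * f bB" if f: "Sol f" for f
  proof -
    let ?g = "\<lambda>x. f 0 * Ext (e []) x + f bB * Ext (e [(True, LB)]) x"
    have "Sol ?g" by (rule Sol_linear_combination[OF Sol_Ext Sol_Ext])
    then have "z f = z ?g"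
      by (rule detD[OF assms(1) f]) (auto simp: Ext_near e_def)
    also have "\<dots> = m * f 0 + n * f bB"
      by (simp add: add scale m_def n_def)
    finally show ?thesis .
  qed
  have "m = 0 \<and> n = 0"
  proof (rule real_edge_function_zero[OF _ assms(3)])
    fix f :: "bd fg \<Rightarrow> real" assume f: "Sol f"
    then show "sum_list (map (\<lambda>u. m * f u + n * f (bB + u)) us) = 0"
      using balancedD[OF assms(2) f] lin[OF Sol_translate[OF f]] by simp
  qed
  then show ?thesis using lin[OF f] by simp
qed

definition deg :: "unit fg \<Rightarrow> real" where
  "deg = fhom (\<lambda>_. 1)"

text \<open>A reduced word in one generator repeats a single letter, so its exponent sum is its
  length up to sign.\<close>

lemma deg_eq_0: "deg v = 0 \<Longrightarrow> v = 0"
proof -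
  have "(if fst c then 1 else - 1) * sum_list (map (\<lambda>(s, x). if s then 1 else - 1 :: real) (c # w)) > 0"
    if "reduced (c # w)" for c :: "bool \<times> unit" and w
    using that
  proof (induction w arbitrary: c)
    case Nil
    then show ?case by (cases c) auto
  next
    case (Cons d w)
    then have "d = c" by (auto simp: linv_def prod_eq_iff)
    with Cons show ?case
      by (cases c; cases "fst c") (fastforce split: if_splits)+
  qed
  moreover assume "deg v = 0"
  ultimately have "Rep_fg v = []"
    using reduced_Rep[of v] by (cases "Rep_fg v") (fastforce simp: deg_def fhom_def)+
  then show "v = 0" by (simp add: Rep_fg_inject[symmetric])
qed

text \<open>Solutions with values in a cyclic group are images of solutions in the free group of rank one.\<close>

lemma functional_zero:
  fixes z :: "(bd fg \<Rightarrow> 'g::group_add) \<Rightarrow> real"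
  assumes det: "det z {0, bB}" and bal: "balanced z us" "us \<noteq> []"
    and cyc: "\<And>(r :: bd fg \<Rightarrow> unit fg) p. Sol r \<Longrightarrow> z (\<lambda>x. fhom (\<lambda>_. p) (r x)) = 0"
    and f: "Sol f"
  shows "z f = 0"
proof -
  define Z where "Z p q = z (Ext (\<lambda>x. if x = [] then p else if x = [(True, LB)] then q else 0))" for p q
  have Z: "z f = Z (f 0) (f bB)" if "Sol f" for f
    unfolding Z_def by (rule detD[OF det that Sol_Ext]) (auto simp: Ext_near)
  have cases: "(\<forall>p q. Z p q = Z 0 q) \<or> (\<forall>p q. Z p q = Z p 0) \<or> (\<forall>q k. Z q (k + q) = Z 0 k)
    \<or> (\<forall>p q. Z p q = Z p 0 + Z 0 q - Z 0 0)"
  proof (rule edge_function_cases[OF _ bal(2)])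
    fix f :: "bd fg \<Rightarrow> 'g" assume f: "Sol f"
    show "sum_list (map (\<lambda>u. Z (f u) (f (bB + u))) us) = 0"
      using balancedD[OF bal(1) f] Z[OF Sol_translate[OF f]] by simp
  qed
  have "Z (fhom (\<lambda>_. p) (h [])) (fhom (\<lambda>_. p) (h [(True, LB)])) = 0" for p and h :: "(bool \<times> bd) list \<Rightarrow> unit fg"
  proof -
    have "Sol (\<lambda>x. fhom (\<lambda>_. p) (Ext h x))"
      by (rule Sol_comp[OF Sol_Ext]) simp
    from Z[OF this] cyc[OF Sol_Ext, of p h] show ?thesis by (simp add: Ext_near)
  qed
  \<comment> \<open>A generator of the cyclic group at one end of the edge and 0 at the other
    reaches all pairs \<open>(p, 0)\<close> and \<open>(0, p)\<close>.\<close>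
  from this[of _ "\<lambda>x. if x = [] then fgen () else 0"] this[of _ "\<lambda>x. if x = [] then 0 else fgen ()"]
  have Z0: "Z p 0 = 0" "Z 0 p = 0" for p by simp_all
  have "Z p q = 0" for p q
    using cases
  proof (elim disjE)
    assume "\<forall>q k. Z q (k + q) = Z 0 k"
    \<comment> \<open>The choice \<open>k = q - p\<close> moves the pair \<open>(p, q)\<close> to
      \<open>(0, q - p)\<close>.\<close>
    from this[rule_format, of p "q - p"] show ?thesis by (simp add: Z0)
  next
    assume "\<forall>p q. Z p q = Z 0 q"
    from this[rule_format, of p q] show ?thesis by (simp only: Z0)
  next
    assume "\<forall>p q. Z p q = Z p 0"
    from this[rule_format, of p q] show ?thesis by (simp only: Z0)
  next
    assume "\<forall>p q. Z p q = Z p 0 + Z 0 q - Z 0 0"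
    from this[rule_format, of p q] show ?thesis by (simp add: Z0)
  qed
  then show ?thesis using Z[OF f] by simp
qed

section \<open>The symmetry exchanging \<open>b\<close> and \<open>d\<close>\<close>

definition swap :: "bd fg \<Rightarrow> bd fg" where
  "swap = fhom (\<lambda>x. case x of LB \<Rightarrow> bD | LD \<Rightarrow> bB)"

lemma swap_simps [simp]:
  "swap (u + v) = swap u + swap v" "swap 0 = 0" "swap bB = bD" "swap bD = bB"
  by (simp_all add: swap_def)

lemma swap_swap [simp]: "swap (swap v) = v"
proof -
  have "swap (swap (fletter c)) = fletter c" for c
    by (cases c; cases "snd c") (simp_all add: swap_def fhom_fletter fletter_False hom_uminus[of "fhom _"])
  then have "swap (swap (lword w)) = lword w" for w
    by (induction w) simp_all
  from this[of "Rep_fg v"] show ?thesis by simp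
qed

text \<open>Exchanging \<open>b\<close> with \<open>d\<close> and inverting \<open>a\<close>
  interchanges the two sides of the relation; this reduces \<open>d\<close>-edges to
  \<open>b\<close>-edges.\<close>

lemma Sol_swap: "Sol f \<Longrightarrow> Sol (\<lambda>x. - f (swap x))"
  unfolding Sol_def
proof
  fix w
  assume "\<forall>w. f (bB + (bB + w)) - f (bB + w) + f w = - f (bD + (bD + w)) + f (bD + w) - f w"
  then have "f (bB + (bB + swap w)) - f (bB + swap w) + f (swap w)
     = - f (bD + (bD + swap w)) + f (bD + swap w) - f (swap w)" ..
  then show "- f (swap (bB + (bB + w))) - (- f (swap (bB + w))) + - f (swap w) =
     - (- f (swap (bD + (bD + w)))) + - f (swap (bD + w)) - (- f (swap w))"
    by simp
qed

lemma balanced_swap: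
  assumes "balanced z us"
  shows "balanced (\<lambda>f. z (\<lambda>x. - f (swap x))) (map swap us)"
  unfolding balanced_def
proof (intro allI impI)
  fix f :: "bd fg \<Rightarrow> 'a" assume "Sol f"
  from balancedD[OF assms Sol_swap[OF this]]
  show "sum_list (map (\<lambda>u. z (\<lambda>x. - f (swap x + u))) (map swap us)) = 0"
    by (simp add: comp_def)
qed

lemma det_swap:
  assumes "det z {0, bD}"
  shows "det (\<lambda>f. z (\<lambda>x. - f (swap x))) {0, bB}"
  unfolding det_def
proof (intro allI impI)
  fix f f' :: "bd fg \<Rightarrow> 'a" assume "Sol f" "Sol f'" "\<forall>x\<in>{0, bB}. f x = f' x"
  then show "z (\<lambda>x. - f (swap x)) = z (\<lambda>x. - f' (swap x))"
    by (intro detD[OF assms] Sol_swap) auto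
qed

section \<open>Functionals given by an element of the kernel\<close>

lemma proj_eq_lword: "\<exists>v. length v \<le> length W \<and> proj W = lword v"
proof (induction W)
  case (Cons c W)
  then obtain v where v: "length v \<le> length W" "proj W = lword v" by blast
  obtain s x where "c = (s, x)" by (cases c)
  then show ?case
    using v by (cases x) (auto intro: exI[of _ v] exI[of _ "(s, LB) # v"] exI[of _ "(s, LD) # v"])
qed (simp add: exI[of _ "[]"])

lemma val_cong:
  assumes "\<And>v. length v \<le> length W \<Longrightarrow> f (lword v + u) = f' (lword v + u)"
  shows "val f W u = val f' W u"
  using assms
proof (induction W)
  case (Cons c W)
  obtain v where v: "length v \<le> length W" "proj W = lword v" using proj_eq_lword by blast
  then have "f (proj W + u) = f' (proj W + u)" using Cons.prems[of v] by simp
  then have "letter_val f c (proj W + u) = letter_val f' c (proj W + u)"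
    by (cases "(f, c, proj W + u)" rule: letter_val.cases) auto
  moreover have "val f W u = val f' W u" using Cons.prems by (intro Cons.IH) simp
  ultimately show ?case by simp
qed simp

lemma det_val: "det (\<lambda>f. \<phi> (val f W 0)) (star_ball (Suc (length W)) 0)"
  unfolding det_def
proof (intro allI impI)
  fix f f' :: "bd fg \<Rightarrow> 'a"
  assume *: "\<forall>x\<in>star_ball (Suc (length W)) 0. f x = f' x"
  have "val f W 0 = val f' W 0"
  proof (rule val_cong)
    fix v :: "(bool \<times> bd) list" assume "length v \<le> length W"
    then have "lword v + 0 \<in> star_ball (Suc (length W)) 0"
      unfolding star_ball_def by (intro CollectI exI[of _ v]) (simp add: star_def)
    then show "f (lword v + 0) = f' (lword v + 0)" using * by blast
  qed
  then show "\<phi> (val f W 0) = \<phi> (val f' W 0)" by simp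
qed

lemma val_winv:
  assumes "Sol f" shows "val f (winv H) (proj H + u) = - val f H u"
proof -
  have "val f (winv H @ H) u = 0"
    using word_eq_invariants(2)[OF word_eq_winv_left assms, of H u] by simp
  then show ?thesis by (simp add: val_append eq_neg_iff_add_eq_0)
qed

lemma proj_winv: "proj (winv H) = - proj H"
  using word_eq_invariants(1)[OF word_eq_winv_left[of H]] by (simp add: eq_neg_iff_add_eq_0)

abbreviation conj_word :: "letter list \<Rightarrow> letter list list \<Rightarrow> letter list" where
  "conj_word W Hs \<equiv> concat (map (\<lambda>H. winv H @ W @ H) Hs)"

lemma val_conj_word:
  assumes "Sol f" "proj W = 0"
  shows "val f (conj_word W Hs) 0 = sum_list (map (\<lambda>H. - val f H 0 + val f W (proj H) + val f H 0) Hs)"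
proof -
  have p: "proj (conj_word W Hs) = 0" for Hs
    by (induction Hs) (simp_all add: assms(2) proj_winv)
  have "val f (winv H @ W @ H) 0 = - val f H 0 + val f W (proj H) + val f H 0" for H
    using val_winv[OF assms(1), of H 0] by (simp add: val_append assms(2) add.assoc)
  then show ?thesis
    by (induction Hs) (simp_all add: val_append[of f "_ @ _ @ _"] p del: append_assoc)
qed

text \<open>After shrinking to an edge, a translation and possibly \<open>swap\<close> bring it to
  \<open>{0, bB}\<close>. The hypothesis \<open>zero\<close> records how \<open>z'\<close> arises
  from \<open>z\<close>, so that properties such as linearity remain at hand.\<close>

lemma functional_on_kernel_zero:
  fixes z :: "(bd fg \<Rightarrow> 'g::group_add) \<Rightarrow> real"
  assumes bal: "balanced z us" "us \<noteq> []" and det: "det z (star_ball R 0)"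
    and zero: "\<And>z' us'. balanced z' us' \<Longrightarrow> us' \<noteq> [] \<Longrightarrow> det z' {0, bB} \<Longrightarrow>
      (\<exists>v. z' = (\<lambda>f. z (\<lambda>x. f (x + v)))) \<or> (\<exists>v. z' = (\<lambda>f. z (\<lambda>x. - f (swap (x + v))))) \<Longrightarrow>
      (\<And>f. Sol f \<Longrightarrow> z' f = 0)"
    and f: "Sol f"
  shows "z f = 0"
proof (rule ccontr)
  assume nz: "z f \<noteq> 0"
  obtain v g where v: "det (\<lambda>f. z (\<lambda>x. f (x + v))) {0, fgen g}"
    using det_edge[OF bal f nz det] by blast
  let ?z = "\<lambda>f. z (\<lambda>x. f (x + v))" and ?us = "map (\<lambda>u. - v + u) us"
  have b: "balanced ?z ?us" by (rule balanced_translate[OF bal(1)])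
  have g: "Sol (\<lambda>x. f (x + - v))" by (rule Sol_translate[OF f])
  have zg: "?z (\<lambda>x. f (x + - v)) = z f" by (simp add: add.assoc)
  show False
  proof (cases g)
    case LB
    then show False using zero[OF b _ _ _ g] v nz zg bal(2) by auto
  next
    case LD
    let ?z' = "\<lambda>f. ?z (\<lambda>x. - f (swap x))"
    have "det ?z' {0, bB}" using v LD det_swap[of ?z] by simp
    then have "?z' (\<lambda>x. - f (swap x + - v)) = 0"
      using zero[OF balanced_swap[OF b], of "\<lambda>x. - f (swap x + - v)"] Sol_swap[OF g] bal(2) by auto
    then show False using nz by (simp add: add.assoc)
  qed
qed

lemma val_add:
  fixes f g :: "bd fg \<Rightarrow> real"
  shows "val (\<lambda>x. f x + g x) W u = val f W u + val g W u"
proof -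
  have "letter_val (\<lambda>x. f x + g x) c u = letter_val f c u + letter_val g c u" for c u
    by (cases "(f, c, u)" rule: letter_val.cases) auto
  then show ?thesis by (induction W) simp_all
qed

lemma val_at: "val (\<lambda>x. f (x + u)) W 0 = val f W u"
  using val_translate[of f W 0 u] by simp

lemma deep_conj_sum:
  assumes "\<And>h. h \<in> set hs \<Longrightarrow> deep k (m h)" "k > 0"
  shows "deep k (sum_list (map (\<lambda>h. - p h + m h + p h) hs)) \<and>
    ent (sum_list (map (\<lambda>h. - p h + m h + p h) hs)) 0 k = sum_list (map (\<lambda>h. ent (m h) 0 k) hs)"
  using assms(1)
proof (induction hs)
  case Nil
  then show ?case using assms(2) by (simp add: deep_def ent_zero)
next
  case (Cons h hs)
  have d: "deep k (- p h + m h + p h)"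
    using ent_conj_deep[of k "m h" _ _ "p h"] Cons.prems[of h] by (auto simp: deep_def)
  have "ent (- p h + m h + p h) 0 k = ent (m h) 0 k"
    using Cons.prems assms(2) by (intro ent_conj_deep) auto
  then show ?case
    using Cons d assms(2) ent_plus_deep_left[OF d, of 0 k] deep_plus[OF d] by simp
qed

text \<open>Closure under \<open>ushift\<close> replaces a nonzero entry at \<open>(a, b)\<close> by
  one at \<open>(0, b - a)\<close>; the least such distance over the whole family is then a depth
  for every member.\<close>

lemma shallowest_entry:
  assumes shift: "\<And>i j. i \<in> I \<Longrightarrow> \<exists>i'\<in>I. \<psi> i' = (ushift ^^ j) (\<psi> i)"
    and "i0 \<in> I" "\<psi> i0 \<noteq> 0"
  obtains k i where "k > 0" "i \<in> I" "ent (\<psi> i) 0 k \<noteq> 0" "\<And>i. i \<in> I \<Longrightarrow> deep k (\<psi> i)"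
proof -
  let ?P = "\<lambda>k. k > 0 \<and> (\<exists>i\<in>I. ent (\<psi> i) 0 k \<noteq> 0)"
  have P: "?P (b - a)" if i: "i \<in> I" "a < b" "ent (\<psi> i) a b \<noteq> 0" for i a b
  proof -
    obtain i' where "i' \<in> I" "\<psi> i' = (ushift ^^ a) (\<psi> i)" using shift[OF i(1)] by blast
    then show ?thesis using i by (auto simp: ent_ushift_funpow intro!: bexI[of _ i'])
  qed
  obtain a b where "a < b" "ent (\<psi> i0) a b \<noteq> 0"
    using assms(3) umat_eqI[of "\<psi> i0" 0] by (auto simp: ent_zero)
  then have "?P (LEAST k. ?P k)" using P[OF assms(2)] by (intro LeastI[of ?P])
  then obtain i where "(LEAST k. ?P k) > 0" "i \<in> I" "ent (\<psi> i) 0 (LEAST k. ?P k) \<noteq> 0" by blast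
  moreover have "deep (LEAST k. ?P k) (\<psi> i)" if i: "i \<in> I" for i
    unfolding deep_def
  proof (intro allI impI)
    fix a b assume ab: "a < b \<and> b < a + (LEAST k. ?P k)"
    then have "b - a < (LEAST k. ?P k)" by linarith
    then have "\<not> ?P (b - a)" by (rule not_less_Least)
    then show "ent (\<psi> i) a b = 0" using P[OF i, of a b] ab by blast
  qed
  ultimately show ?thesis by (rule that)
qed

text \<open>At the shallowest entry over all homomorphisms to matrices, every conjugate contributes
  the same nonzero number. This forces a torsion element of \<open>G\<close> into the
  kernel.\<close>

lemma fg_conj_torsion_free:
  fixes v :: "'x fg"
  assumes "hs \<noteq> []" "sum_list (map (\<lambda>h. - h + v + h) hs) = 0"
  shows "v = 0"
proof (rule ccontr)
  assume "v \<noteq> 0"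
  then obtain h :: "'x \<Rightarrow> umat" where h: "fhom h v \<noteq> 0" by (rule fg_residually_umat)
  let ?I = "{\<phi> :: 'x fg \<Rightarrow> umat. \<forall>x y. \<phi> (x + y) = \<phi> x + \<phi> y}"
  obtain k \<phi> where k: "k > 0" "\<phi> \<in> ?I" "ent (\<phi> v) 0 k \<noteq> 0" "\<And>\<phi>. \<phi> \<in> ?I \<Longrightarrow> deep k (\<phi> v)"
  proof (rule shallowest_entry[of ?I "\<lambda>\<phi>. \<phi> v" "fhom h"])
    show "\<exists>\<phi>'\<in>?I. \<phi>' v = (ushift ^^ j) (\<phi> v)" if "\<phi> \<in> ?I" for \<phi> j
      using that by (intro bexI[of _ "\<lambda>x. (ushift ^^ j) (\<phi> x)"]) (simp_all add: ushift_funpow_plus)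
  qed (use h in auto)
  have add: "\<phi> (x + y) = \<phi> x + \<phi> y" for x y using k(2) by simp
  have "\<phi> (sum_list (map (\<lambda>h. - h + v + h) hs)) = sum_list (map (\<lambda>h. - \<phi> h + \<phi> v + \<phi> h) hs)"
    by (induction hs) (simp_all add: add hom_uminus[of \<phi>, OF add])
  then have "ent 0 0 k = sum_list (map (\<lambda>h. ent (\<phi> v) 0 k) hs)"
    using deep_conj_sum[of hs k "\<lambda>_. \<phi> v" \<phi>] k assms(2) hom_uminus(2)[of \<phi>, OF add] by simp
  then show False using k assms(1) by (simp add: sum_list_triv ent_zero)
qed

lemma sum_conj_val_zero:
  assumes "Sol f" "proj W = 0" "word_eq (conj_word W Hs) []"
  shows "sum_list (map (\<lambda>H. - val f H 0 + val f W (proj H) + val f H 0) Hs) = 0"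
  using val_conj_word[OF assms(1,2), of Hs] word_eq_invariants(2)[OF assms(3,1), of 0] by simp

text \<open>Three targets are treated in turn: the reals, where functionals are linear; cyclic
  groups, embedded in the reals by \<open>deg\<close>; and matrices, where vanishing on cyclic
  solutions disposes of each case of the functional equation.\<close>

lemma kernel_conj_torsion_free:
  assumes W: "proj W = 0" and Hs: "Hs \<noteq> []" and eq: "word_eq (conj_word W Hs) []"
  shows "abs_grp W = 0"
proof (rule kernel_residually_umat[OF W])
  note sum0 = sum_conj_val_zero[OF _ W eq]
  let ?us = "map proj Hs"
  have us: "?us \<noteq> []" using Hs by simp
  have real: "val r W 0 = 0" if r: "Sol r" for r :: "bd fg \<Rightarrow> real"
  proof (rule functional_on_kernel_zero[OF _ us _ _ r])
    let ?z = "\<lambda>f :: bd fg \<Rightarrow> real. val f W 0"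
    show "det ?z (star_ball (Suc (length W)) 0)" using det_val[of "\<lambda>x. x" W] by simp
    show "balanced ?z ?us"
      unfolding balanced_def
    proof (intro allI impI)
      fix f :: "bd fg \<Rightarrow> real" assume "Sol f"
      from sum0[OF this] show "sum_list (map (\<lambda>u. ?z (\<lambda>x. f (x + u))) ?us) = 0"
        by (simp add: val_at comp_def)
    qed
    fix z' us' and f :: "bd fg \<Rightarrow> real"
    assume z': "balanced z' us'" "us' \<noteq> []" "det z' {0, bB}" and f: "Sol f"
      and or: "(\<exists>v. z' = (\<lambda>f. ?z (\<lambda>x. f (x + v)))) \<or> (\<exists>v. z' = (\<lambda>f. ?z (\<lambda>x. - f (swap (x + v)))))"
    show "z' f = 0"
    proof (rule real_functional_zero[OF z'(3,1,2) _ _ f])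
      have s: "val (\<lambda>x. c * f x) W u = c * val f W u" for c u and f :: "bd fg \<Rightarrow> real"
        by (rule val_comp) (simp add: distrib_left)
      show "z' (\<lambda>x. f x + g x) = z' f + z' g" for f g
        using or by (auto simp: val_add s[of "- 1", simplified])
      show "z' (\<lambda>x. c * f x) = c * z' f" for c f
        using or s by (auto simp: s[of "- 1", simplified])
    qed
  qed
  have cyclic: "val r W 0 = 0" if "Sol r" for r :: "bd fg \<Rightarrow> unit fg"
  proof (rule deg_eq_0)
    have "Sol (\<lambda>x. deg (r x))" by (rule Sol_comp[OF that]) (simp add: deg_def)
    then have "val (\<lambda>x. deg (r x)) W 0 = 0" by (rule real)
    moreover have "val (\<lambda>x. deg (r x)) W 0 = deg (val r W 0)" by (rule val_comp) (simp add: deg_def)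
    ultimately show "deg (val r W 0) = 0" by simp
  qed
  fix f :: "bd fg \<Rightarrow> umat" assume f: "Sol f"
  show "val f W 0 = 0"
  proof (rule ccontr)
    assume nz: "val f W 0 \<noteq> 0"
    \<comment> \<open>The minimum is taken over all solutions at once, so the depth bound also
      covers every translate.\<close>
    obtain k g where k: "k > 0" "Sol g" "ent (val g W 0) 0 k \<noteq> 0"
      "\<And>g :: bd fg \<Rightarrow> umat. Sol g \<Longrightarrow> deep k (val g W 0)"
    proof (rule shallowest_entry[of "Collect Sol" "\<lambda>f. val f W 0" f])
      show "\<exists>g'\<in>Collect Sol. val g' W 0 = (ushift ^^ j) (val g W 0)" if "g \<in> Collect Sol" for g j
        using that by (intro bexI[of _ "\<lambda>x. (ushift ^^ j) (g x)"])
          (simp_all add: val_comp Sol_comp ushift_funpow_plus)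
    qed (use f nz in auto)
    let ?z = "\<lambda>f :: bd fg \<Rightarrow> umat. ent (val f W 0) 0 k"
    have "?z g = 0"
    proof (rule functional_on_kernel_zero[OF _ us _ _ k(2)])
      show "det ?z (star_ball (Suc (length W)) 0)" by (rule det_val)
      show "balanced ?z ?us"
        unfolding balanced_def
      proof (intro allI impI)
        fix g :: "bd fg \<Rightarrow> umat" assume g: "Sol g"
        have "deep k (val g W u)" for u
          using k(4)[OF Sol_translate[OF g, of u]] by (simp add: val_at)
        then have "sum_list (map (\<lambda>H. ent (val g W (proj H)) 0 k) Hs) = ent 0 0 k"
          using deep_conj_sum[of Hs k "\<lambda>H. val g W (proj H)" "\<lambda>H. val g H 0"] sum0[OF g] k(1) by simp
        then show "sum_list (map (\<lambda>u. ?z (\<lambda>x. g (x + u))) ?us) = 0"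
          using k(1) by (simp add: val_at comp_def ent_zero)
      qed
      fix z' us' and g :: "bd fg \<Rightarrow> umat"
      assume z': "balanced z' us'" "us' \<noteq> []" "det z' {0, bB}" and g: "Sol g"
        and or: "(\<exists>v. z' = (\<lambda>f. ?z (\<lambda>x. f (x + v)))) \<or> (\<exists>v. z' = (\<lambda>f. ?z (\<lambda>x. - f (swap (x + v)))))"
      show "z' g = 0"
      proof (rule functional_zero[OF z'(3,1,2) _ g])
        fix r :: "bd fg \<Rightarrow> unit fg" and p :: umat
        assume r: "Sol r"
        have c: "?z (\<lambda>x. fhom (\<lambda>_. p) (r' x)) = 0" if "Sol r'" for r' :: "bd fg \<Rightarrow> unit fg"
          using cyclic[OF that] val_comp[of "fhom (\<lambda>_. p)" r' W 0] k(1) by (simp add: ent_zero)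
        from or show "z' (\<lambda>x. fhom (\<lambda>_. p) (r x)) = 0"
        proof (elim disjE exE)
          fix v assume "z' = (\<lambda>f. ?z (\<lambda>x. f (x + v)))"
          then show ?thesis using c[OF Sol_translate[OF r, of v]] by simp
        next
          fix v assume "z' = (\<lambda>f. ?z (\<lambda>x. - f (swap (x + v))))"
          then show ?thesis
            using c[OF Sol_translate[OF Sol_swap[OF r], of v]]
            by (simp add: hom_uminus[of "fhom _"])
        qed
      qed
    qed
    then show False using k(3) by simp
  qed
qed

lemma abs_grp_surj: obtains w where "x = abs_grp w"
proof -
  have "\<exists>w. x = abs_grp w" by (induction x rule: grp.abs_induct) blast
  then show ?thesis using that by blast
qed

lemma abs_grp_winv: "abs_grp (winv w) = - abs_grp w"
  by (simp add: uminus_grp.abs_eq)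

lemma grp_conj_torsion_free:
  fixes x :: grp
  assumes "hs \<noteq> []" "sum_list (map (\<lambda>h. - h + x + h) hs) = 0"
  shows "x = 0"
proof -
  obtain W where W: "x = abs_grp W" by (rule abs_grp_surj)
  have "\<exists>Hs. hs = map abs_grp Hs"
  proof (induction hs)
    case (Cons h hs)
    then obtain Hs where "hs = map abs_grp Hs" by blast
    moreover obtain H where "h = abs_grp H" by (rule abs_grp_surj)
    ultimately show ?case by (intro exI[of _ "H # Hs"]) simp
  qed simp
  then obtain Hs where Hs: "hs = map abs_grp Hs" by blast
  have "abs_grp (conj_word W Hs) = sum_list (map (\<lambda>h. - h + x + h) hs)"
    unfolding Hs W by (induction Hs) (simp_all add: abs_grp_append abs_grp_winv add.assoc)
  then have eq: "word_eq (conj_word W Hs) []"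
    using assms(2) abs_grp_eq_iff[of "conj_word W Hs" "[]"] by simp
  have "proj (conj_word W Hs) = sum_list (map (\<lambda>h. - h + proj W + h) (map proj Hs))"
    by (induction Hs) (simp_all add: proj_winv add.assoc)
  then have sum0: "sum_list (map (\<lambda>h. - h + proj W + h) (map proj Hs)) = 0"
    using word_eq_invariants(1)[OF eq] by simp
  have ne: "Hs \<noteq> []" using assms(1) Hs by simp
  have "map proj Hs \<noteq> []" using ne by simp
  from fg_conj_torsion_free[OF this sum0] have "proj W = 0" .
  from kernel_conj_torsion_free[OF this ne eq] show ?thesis by (simp only: W)
qed

lemma word_eq_parity:
  "word_eq v w \<Longrightarrow> even (count_list (map snd v) Ga) = even (count_list (map snd w) Ga)"
  by (induction rule: word_eq.induct) (auto simp: rel_lhs_def rel_rhs_def pos_def neg_def)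

text \<open>Abelianized, the relation reads \<open>a = - a\<close>; hence the invariant is a parity
  and not an exponent sum.\<close>

lemma grp_gen_a_neq_0: "grp_gen Ga \<noteq> 0"
proof
  assume "grp_gen Ga = 0"
  then have "word_eq [(True, Ga)] []"
    by (simp add: abs_grp_eq_iff[symmetric])
  from word_eq_parity[OF this] show False by simp
qed

text \<open>With \<open>c\<close> conjugation by \<open>b\<close>, the element is
  \<open>c (c a) - c a + a\<close>. If \<open>c a\<close> is below \<open>a\<close>, then
  \<open>- c a + a\<close> is positive; if above, applying \<open>c\<close> shows that
  \<open>c (c a) - c a\<close> is.\<close>

lemma biordered_alternating_pos:
  fixes L :: "'g::group_add \<Rightarrow> 'g \<Rightarrow> bool"
  assumes trans: "\<And>x y z. L x y \<Longrightarrow> L y z \<Longrightarrow> L x z"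
    and total: "\<And>x y. x \<noteq> y \<Longrightarrow> L x y \<or> L y x"
    and mono: "\<And>x y z. L x y \<Longrightarrow> L (z + x) (z + y)" "\<And>x y z. L x y \<Longrightarrow> L (x + z) (y + z)"
    and a: "L 0 a"
  shows "L 0 (- b + (- b + (a + (b + (- a + (b + a))))))"
proof -
  let ?c = "\<lambda>x. - b + (x + b)"
  have pos_add: "L 0 x \<Longrightarrow> L 0 y \<Longrightarrow> L 0 (x + y)" for x y
    using trans[of 0 x "x + y"] mono(1)[of 0 y x] by simp
  have conj: "L x y \<Longrightarrow> L (?c x) (?c y)" for x y
    using mono by blast
  have ca: "L 0 (?c a)" using conj[OF a] by simp
  have eq: "- b + (- b + (a + (b + (- a + (b + a))))) = ?c (?c a) + (- ?c a + a)"
    by (simp only: add.assoc minus_add minus_minus add_minus_cancel)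
  consider "?c a = a" | "L (?c a) a" | "L a (?c a)" using total by blast
  then show ?thesis
  proof cases
    case 1
    then have "- ?c a + a = 0" by (metis left_minus)
    then show ?thesis unfolding eq using conj[OF ca] by simp
  next
    case 2
    then have 2: "L 0 (- ?c a + a)" using mono(1)[of "?c a" a "- ?c a"] by simp
    have "L 0 (?c (?c a))" using conj[OF ca] by simp
    from pos_add[OF this 2] show ?thesis unfolding eq .
  next
    case 3
    then have "L (?c a) (?c (?c a))" by (rule conj)
    then have "L 0 (?c (?c a) + - ?c a)" using mono(2)[of "?c a" "?c (?c a)" "- ?c a"] by simp
    then have "L 0 ((?c (?c a) + - ?c a) + a)" using a by (rule pos_add)
    then show ?thesis unfolding eq by (simp only: add.assoc)
  qed
qed

lemma grp_not_biorderable: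
  fixes L :: "grp \<Rightarrow> grp \<Rightarrow> bool"
  assumes irrefl: "\<And>x. \<not> L x x"
    and trans: "\<And>x y z. L x y \<Longrightarrow> L y z \<Longrightarrow> L x z"
    and total: "\<And>x y. x \<noteq> y \<Longrightarrow> L x y \<or> L y x"
    and mono: "\<And>x y z. L x y \<Longrightarrow> L (z + x) (z + y)" "\<And>x y z. L x y \<Longrightarrow> L (x + z) (y + z)"
  shows False
proof -
  let ?a = "grp_gen Ga" and ?b = "grp_gen Gb" and ?d = "grp_gen Gd"
  let ?w = "\<lambda>a b :: grp. - b + (- b + (a + (b + (- a + (b + a)))))"
  let ?v = "\<lambda>a b :: grp. - b + (- b + (- a + (b + (a + (b + - a)))))"
  have neg: "L (- x) 0" if "L 0 x" for x using mono(1)[OF that, of "- x"] by simp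
  have neg': "L 0 (- x)" if "L x 0" for x using mono(1)[OF that, of "- x"] by simp
  have pos: "L 0 (?w a b)" if "L 0 a" for a b
    by (rule biordered_alternating_pos[of L, OF trans total mono that])
  \<comment> \<open>The reversed order is again a bi-order.\<close>
  have opp: "L (?w a b) 0" if "L a 0" for a b
  proof (rule biordered_alternating_pos[of "\<lambda>x y. L y x"])
    show "L y x \<Longrightarrow> L z y \<Longrightarrow> L z x" for x y z by (rule trans)
    show "x \<noteq> y \<Longrightarrow> L y x \<or> L x y" for x y using total by blast
  qed (fact mono that)+
  \<comment> \<open>The right-hand side of the relation is the left-hand pattern at
    \<open>- a\<close> and \<open>d\<close>, hence of opposite sign.\<close>
  have v: "?v a b = ?w (- a) b" for a b by simp
  have eq: "?w ?a ?b = ?v ?a ?d" by (rule grp_relation)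
  have "L 0 ?a \<or> L ?a 0" using total[of 0 ?a] grp_gen_a_neq_0 by simp
  then show False
  proof
    assume a: "L 0 ?a"
    have "L (?v ?a ?d) 0" unfolding v by (rule opp[OF neg[OF a]])
    then show False using trans[OF pos[OF a, of ?b]] irrefl unfolding eq by blast
  next
    assume a: "L ?a 0"
    have "L 0 (?v ?a ?d)" unfolding v by (rule pos[OF neg'[OF a]])
    from trans[OF this, of 0] show False using opp[OF a, of ?b] irrefl unfolding eq by blast
  qed
qed

section \<open>Transfer to the group of word classes as sets\<close>

definition grp_class :: "grp \<Rightarrow> letter list set" where
  "grp_class x = {v. abs_grp v = x}"

lemma word_class_eq: "word_class w = grp_class (abs_grp w)"
  by (auto simp: word_class_def grp_class_def abs_grp_eq_iff[symmetric])

lemma inj_grp_class: "grp_class x = grp_class y \<longleftrightarrow> x = y"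
  by (rule abs_grp_surj[of x]) (auto simp: grp_class_def)

lemma carrier_onerel: "carrier onerel_group = range grp_class"
proof -
  have "range word_class = grp_class ` range abs_grp"
    by (auto simp: word_class_eq)
  moreover have "range abs_grp = UNIV"
    using abs_grp_surj by (metis rangeI UNIV_eq_I)
  ultimately show ?thesis by (simp add: onerel_group_def)
qed

lemma one_onerel: "\<one>\<^bsub>onerel_group\<^esub> = grp_class 0"
  by (simp add: onerel_group_def word_class_eq)

lemma mult_onerel: "grp_class x \<otimes>\<^bsub>onerel_group\<^esub> grp_class y = grp_class (x + y)"
proof -
  obtain v w where "x = abs_grp v" "y = abs_grp w" by (metis abs_grp_surj)
  then show ?thesis
    by (auto simp: onerel_group_def grp_class_def abs_grp_eq_iff[symmetric] abs_grp_append)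
qed

lemma group_onerel: "group onerel_group"
proof (rule groupI)
  fix x assume "x \<in> carrier onerel_group"
  then obtain u where "x = grp_class u" by (auto simp: carrier_onerel)
  then show "\<exists>y\<in>carrier onerel_group. y \<otimes>\<^bsub>onerel_group\<^esub> x = \<one>\<^bsub>onerel_group\<^esub>"
    by (intro bexI[of _ "grp_class (- u)"]) (simp_all add: carrier_onerel mult_onerel one_onerel)
qed (auto simp: carrier_onerel mult_onerel one_onerel add.assoc)

lemma inv_onerel: "inv\<^bsub>onerel_group\<^esub> grp_class x = grp_class (- x)"
  by (rule group.inv_equality[OF group_onerel]) (simp_all add: carrier_onerel mult_onerel one_onerel)

lemma conj_prod_onerel:
  "conj_prod onerel_group (grp_class x) (map grp_class hs) = grp_class (sum_list (map (\<lambda>h. - h + x + h) hs))"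
  by (induction hs) (simp_all add: conj_prod_def conj_def one_onerel inv_onerel mult_onerel)

theorem theorem1p2:
  shows "generalized_torsion_free onerel_group \<and> \<not> bi_orderable onerel_group"
proof
  show "generalized_torsion_free onerel_group"
    unfolding generalized_torsion_free_def
  proof
    assume "\<exists>g. generalized_torsion onerel_group g"
    then obtain g hs where g: "g \<in> carrier onerel_group" "g \<noteq> \<one>\<^bsub>onerel_group\<^esub>"
      and hs: "hs \<noteq> []" "set hs \<subseteq> carrier onerel_group" "conj_prod onerel_group g hs = \<one>\<^bsub>onerel_group\<^esub>"
      by (auto simp: generalized_torsion_def)
    obtain x where x: "g = grp_class x" using g(1) by (auto simp: carrier_onerel)
    have "\<forall>y\<in>set hs. \<exists>x. y = grp_class x"
      using hs(2) unfolding carrier_onerel by blast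
    then have "\<exists>ks. hs = map grp_class ks" by (simp only: ex_map_conv)
    then obtain ks where ks: "hs = map grp_class ks" by blast
    have "sum_list (map (\<lambda>h. - h + x + h) ks) = 0"
      using hs(3) by (simp only: x ks conj_prod_onerel one_onerel inj_grp_class)
    moreover have "ks \<noteq> []" using hs(1) ks by simp
    ultimately have "x = 0" using grp_conj_torsion_free by blast
    then show False using g(2) by (simp add: x one_onerel)
  qed
  show "\<not> bi_orderable onerel_group"
  proof
    assume "bi_orderable onerel_group"
    then obtain less where less:
      "\<forall>x\<in>carrier onerel_group. \<not> less x x"
      "\<forall>x\<in>carrier onerel_group. \<forall>y\<in>carrier onerel_group. \<forall>z\<in>carrier onerel_group.
         less x y \<longrightarrow> less y z \<longrightarrow> less x z"
      "\<forall>x\<in>carrier onerel_group. \<forall>y\<in>carrier onerel_group. x \<noteq> y \<longrightarrow> less x y \<or> less y x"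
      "\<forall>x\<in>carrier onerel_group. \<forall>y\<in>carrier onerel_group. \<forall>z\<in>carrier onerel_group. less x y \<longrightarrow>
        less (z \<otimes>\<^bsub>onerel_group\<^esub> x) (z \<otimes>\<^bsub>onerel_group\<^esub> y) \<and>
        less (x \<otimes>\<^bsub>onerel_group\<^esub> z) (y \<otimes>\<^bsub>onerel_group\<^esub> z)"
      unfolding bi_orderable_def by (elim exE conjE) (rule that)
    have c: "grp_class x \<in> carrier onerel_group" for x by (simp add: carrier_onerel)
    show False
    proof (rule grp_not_biorderable[of "\<lambda>x y. less (grp_class x) (grp_class y)"])
      show "\<not> less (grp_class x) (grp_class x)" for x
        by (rule less(1)[rule_format, OF c])
      show "less (grp_class x) (grp_class y) \<Longrightarrow> less (grp_class y) (grp_class z)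
        \<Longrightarrow> less (grp_class x) (grp_class z)" for x y z
        by (rule less(2)[rule_format, OF c c c])
      show "less (grp_class x) (grp_class y) \<or> less (grp_class y) (grp_class x)" if "x \<noteq> y" for x y
        by (rule less(3)[rule_format, OF c c]) (simp add: inj_grp_class that)
      show "less (grp_class (z + x)) (grp_class (z + y))" "less (grp_class (x + z)) (grp_class (y + z))"
        if "less (grp_class x) (grp_class y)" for x y z
        using less(4)[rule_format, OF c c c that, of z] by (simp_all only: mult_onerel)
    qed
  qed
qed

end
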